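(* Let $2<p\le q<\infty$, let $\alpha\in\mathbb{R}$ satisfy $\alpha\le p/q'-1$, and let $\mu$ be a positive Borel measure on $\mathbb{C}_+$. Then $$\mathcal{L}\colon L^p(\mathbb{R}_+,x^\alpha\,dx)\to L^q(\mathbb{C}_+,d\mu)$$ is bounded (i.e. there is a constant $C>0$ such that $\left(\int_{\mathbb{C}_+}|\mathcal{L}f|^q\,d\mu\right)^{1/q}\le C\left(\int_0^\infty|f(x)|^px^\alpha\,dx\right)^{1/p}$ for all $f\in L^p(\mathbb{R}_+,x^\alpha\,dx)$) if and only if there is a constant $C_0>0$ such that $$\mu(Q_I)\le C_0|I|^{q/p'-\alpha q/p}\quad\text{for all intervals } I\subset\mathbb{R}.$$
   Context: $\mathbb{R}_+=(0,\infty)$ and $\mathbb{C}_+=\{z\in\mathbb{C}:\operatorname{Im}z>0\}$. Conjugate exponents are $p'=p/(p-1)$, $q'=q/(q-1)$. The Laplace transform is $\mathcal{L}f(z)=\int_0^\infty f(t)e^{2\pi i tz}\,dt$ for $z\in\mathbb{C}_+$. For a bounded interval $I\subset\mathbb{R}$ of length $|I|$, the Carleson box is $Q_I=\{x+iy: x\in I,\ 0<y\le|I|\}\subset\mathbb{C}_+$. *)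

theory Defs
  imports "HOL-Analysis.Analysis"
begin

definition conj_exponent :: "real \<Rightarrow> real" where
  "conj_exponent p = p / (p - 1)"

definition upper_half_plane :: "complex set" where
  "upper_half_plane = {z. 0 < Im z}"

text \<open>
  Elements of $L^p$ are represented by measurable functions, not by classes modulo null sets.
  On \<^term>\<open>Lp_space M p\<close> the Bochner integral in \<open>Lp_norm\<close> is that of an integrable function;
  outside of it the value of \<open>Lp_norm\<close> carries no meaning.
\<close>

definition Lp_space :: "'a measure \<Rightarrow> real \<Rightarrow> ('a \<Rightarrow> complex) set" where
  "Lp_space M p = {f \<in> borel_measurable M. integrable M (\<lambda>x. cmod (f x) powr p)}"

definition Lp_norm :: "'a measure \<Rightarrow> real \<Rightarrow> ('a \<Rightarrow> complex) \<Rightarrow> real" where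
  "Lp_norm M p f = (LINT x|M. cmod (f x) powr p) powr (1 / p)"

text \<open>
  The bound alone would not suffice: the Bochner integral of a non-integrable function is 0,
  so that \<open>T f\<close> belongs to the target space is part of the definition.
\<close>

definition bounded_Lp_Lq ::
  "'a measure \<Rightarrow> real \<Rightarrow> 'b measure \<Rightarrow> real \<Rightarrow> (('a \<Rightarrow> complex) \<Rightarrow> 'b \<Rightarrow> complex) \<Rightarrow> bool" where
  "bounded_Lp_Lq M p N q T \<longleftrightarrow>
     (\<exists>C>0. \<forall>f\<in>Lp_space M p. T f \<in> Lp_space N q \<and> Lp_norm N q (T f) \<le> C * Lp_norm M p f)"

definition power_weight :: "real \<Rightarrow> real measure" where
  "power_weight \<alpha> = density (restrict_space lborel {0<..}) (\<lambda>x. ennreal (x powr \<alpha>))"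

definition laplace :: "(real \<Rightarrow> complex) \<Rightarrow> complex \<Rightarrow> complex" where
  "laplace f z = (LINT t:{0<..}|lborel. f t * exp (2 * of_real pi * \<i> * of_real t * z))"

definition carleson_box :: "real set \<Rightarrow> complex set" where
  "carleson_box I = {z. Re z \<in> I \<and> 0 < Im z \<and> Im z \<le> measure lborel I}"

end

theory Submission
  imports Defs
begin

text \<open>
  Put \<open>s = q/p' - \<alpha> q/p\<close>; the hypothesis on \<open>\<alpha>\<close> gives \<open>s > 0\<close>. For the sufficiency, cut \<open>f\<close> into
  dyadic blocks \<open>f\<^sub>i\<close> on \<open>[T\<^sub>i, 2 T\<^sub>i)\<close> and put \<open>M\<^sub>i = T\<^sub>i\<^bsup>s/q\<^esup> A\<^sub>i\<close>, where \<open>A\<^sub>i\<close> is the weighted \<open>L\<^sup>p\<close> norm of \<open>f\<^sub>i\<close>.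
  Trivially \<open>|L f\<^sub>i| \<le> c M\<^sub>i\<close>, and a \<open>TT\<^sup>*\<close> argument with a Schur test over Carleson boxes gives
  \<open>\<integral> |L f\<^sub>i|\<^sup>2 d\<mu> \<le> B T\<^sub>i\<^bsup>-s\<^esup> M\<^sub>i\<^sup>2\<close>. Since \<open>q > 2\<close>, the \<open>q\<close>-th power of \<open>\<Sum> |L f\<^sub>i|\<close> is dominated by the sum over
  \<open>j \<le> i\<close> of \<open>|L f\<^sub>i| |L f\<^sub>j| (\<Sum>\<^bsub>l \<le> j\<^esub> |L f\<^sub>l|)\<^bsup>q-2\<^esup>\<close>; the square bound on the two high blocks and the uniform
  bound on the low ones leave geometrically decaying sums, so \<open>\<integral> |L f|\<^sup>q d\<mu> \<le> K \<Sum> A\<^sub>i\<^sup>q\<close>, and \<open>p \<le> q\<close> finishes.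
\<close>

section \<open>Real interpolation over dyadic blocks\<close>

text \<open>Hausdorff-Young stops at exponent 2, so for p > 2 a block is known only through two
  endpoint bounds, between which the proof interpolates by hand. The \<open>L^1\<close> norm of a
  block at scale T is at most c T^(1 - (1 + \<alpha>)/p) A = c M, because s/q = 1 - (1 +
  \<alpha>)/p; this sup bound does not involve \<open>\<mu>\<close>. The \<open>L^2\<close> norm of
  the block, which p > 2 makes available, yields the square bound, and there \<open>\<mu>\<close>
  enters through the growth R^s of its boxes. On one block the two combine to M^(q-2) T^(-s) M^2 =
  A^q: each block is exactly scale invariant, and nothing decays from block to block. Decay comes
  from the mixed terms alone. Writing q = 1 + 1 + (q - 2), with the two factors of highest frequency
  estimated in \<open>L^2\<close> and the rest in sup norm, gains 2^(-(i-j)(s/2 - s/q)) and, inside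
  the low sum, 2^(-(j-l)s/q); both are summable because q > 2 and s > 0. The Schur test needs a
  kernel that decays faster than the boxes grow, whatever s is. Hence the indicator of a block is
  dominated by a function with a free power m, whose kernel decays with order m + 1 > s.\<close>

lemma powr_Bernoulli:
  fixes x r :: real
  assumes "0 \<le> x" "1 \<le> r"
  shows "1 + r * (x - 1) \<le> x powr r"
proof (cases "x = 0")
  case True
  then show ?thesis using assms by auto
next
  case False
  then have "(x powr r) powr (1/r) * 1 powr (1 - 1/r) \<le> (1/r) * x powr r + (1 - 1/r) * 1"
    using assms False by (intro Youngs_inequality_0[of "1/r" "1 - 1/r" "x powr r" 1]) auto
  then have "x \<le> (1/r) * x powr r + (1 - 1/r)"
    using assms False by (simp add: powr_powr)
  then have "r * x \<le> r * ((1/r) * x powr r + (1 - 1/r))"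
    using assms by (intro mult_left_mono) auto
  also have "r * ((1/r) * x powr r + (1 - 1/r)) = x powr r + (r - 1)"
    using assms by (simp add: algebra_simps)
  finally show ?thesis by (simp add: algebra_simps)
qed

text \<open>Convexity: the graph of the r-th power lies above its tangent at a + g, here evaluated
  at a. It is Bernoulli's inequality at a / (a + g), rescaled.\<close>

lemma powr_add_le_tangent:
  fixes a g r :: real
  assumes "0 \<le> a" "0 \<le> g" "1 \<le> r"
  shows "(a + g) powr r \<le> a powr r + r * (g * (a + g) powr (r - 1))"
proof (cases "a + g = 0")
  case True
  then show ?thesis using assms by (auto simp: add_nonneg_eq_0_iff)
next
  case False
  define S where "S = a + g"
  have S: "0 < S" using False assms by (auto simp: S_def)
  have "S powr r * (1 + r * (a / S - 1)) \<le> S powr r * (a / S) powr r"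
    using assms S by (intro mult_left_mono powr_Bernoulli) auto
  also have "\<dots> = a powr r"
    using assms S by (simp add: powr_divide)
  also have "S powr r * (1 + r * (a / S - 1)) = S powr r - r * (g * S powr (r - 1))"
    using S by (simp add: powr_diff S_def field_simps)
  finally show ?thesis by (simp add: S_def)
qed

text \<open>A discrete form of d(S^r) = r S^(r-1) dS: each new summand raises the power of the
  partial sum by at most the tangent increment at the new endpoint.\<close>

lemma sum_powr_le_telescope:
  fixes g :: "nat \<Rightarrow> real"
  assumes "\<And>i. 0 \<le> g i" "1 \<le> r"
  shows "(\<Sum>i<n. g i) powr r \<le> r * (\<Sum>i<n. g i * (\<Sum>j\<le>i. g j) powr (r - 1))"
proof (induction n)
  case (Suc n)
  have "(\<Sum>i<Suc n. g i) powr r \<le>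
      (\<Sum>i<n. g i) powr r + r * (g n * ((\<Sum>i<n. g i) + g n) powr (r - 1))"
    using assms by (simp add: powr_add_le_tangent sum_nonneg)
  also have "(\<Sum>i<n. g i) + g n = (\<Sum>j\<le>n. g j)"
    by (simp flip: lessThan_Suc_atMost)
  finally show ?case using Suc by (simp add: algebra_simps)
qed simp

text \<open>Telescoping twice, first with exponent q and then with q - 1 on each inner partial sum.
  The order j \<le> i is the point: the remaining power q - 2 falls on the partial sum up to the
  smaller index.\<close>

lemma sum_powr_le_double_sum:
  fixes g :: "nat \<Rightarrow> real"
  assumes "\<And>i. 0 \<le> g i" "2 \<le> q"
  shows "(\<Sum>i<n. g i) powr q \<le>
    q * (q - 1) * (\<Sum>i<n. \<Sum>j\<le>i. g i * g j * (\<Sum>l\<le>j. g l) powr (q - 2))"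
proof -
  have *: "(\<Sum>j\<le>i. g j) powr (q - 1) \<le>
      (q - 1) * (\<Sum>j\<le>i. g j * (\<Sum>l\<le>j. g l) powr (q - 2))" for i
    using sum_powr_le_telescope[of g "q - 1" "Suc i"] assms
    by (simp add: lessThan_Suc_atMost)
  have "(\<Sum>i<n. g i) powr q \<le> q * (\<Sum>i<n. g i * (\<Sum>j\<le>i. g j) powr (q - 1))"
    using assms by (intro sum_powr_le_telescope) auto
  also have "\<dots> \<le> q * (\<Sum>i<n. g i * ((q - 1) * (\<Sum>j\<le>i. g j * (\<Sum>l\<le>j. g l) powr (q - 2))))"
    using assms * by (intro mult_left_mono sum_mono) auto
  also have "\<dots> = q * (q - 1) * (\<Sum>i<n. \<Sum>j\<le>i. g i * g j * (\<Sum>l\<le>j. g l) powr (q - 2))"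
    by (simp add: sum_distrib_left mult_ac)
  finally show ?thesis .
qed

text \<open>Jensen for the convex combination of b and a / (1 - \<theta>) with weights \<theta> and
  1 - \<theta>. The factor \<theta> < 1 in front of b^q makes recursions of the form b' = \<theta> b
  + a contract.\<close>

lemma powr_geometric_step:
  fixes b a \<theta> q :: real
  assumes "0 < \<theta>" "\<theta> < 1" "0 < b" "0 < a" "1 \<le> q"
  shows "(\<theta> * b + a) powr q \<le> \<theta> * b powr q + (1 - \<theta>) powr (1 - q) * a powr q"
proof -
  have "((1 - \<theta>) *\<^sub>R (a / (1 - \<theta>)) + \<theta> *\<^sub>R b) powr q
      \<le> (1 - \<theta>) * (a / (1 - \<theta>)) powr q + \<theta> * b powr q"
    using assms by (intro convex_onD[OF powr_convex]) auto
  also have "(1 - \<theta>) * (a / (1 - \<theta>)) powr q = (1 - \<theta>) powr (1 - q) * a powr q"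
    using assms by (simp add: powr_divide powr_diff)
  finally show ?thesis using assms by (simp add: add_ac)
qed

text \<open>Young's convolution inequality for \<open>l^1 * l^q\<close> with a geometric kernel; 1 /
  (1 - \<theta>) is the \<open>l^1\<close> norm of that kernel. The geometric kernel allows a proof
  by the recursion \<open>b_Suc\<close>.\<close>

lemma sum_geometric_convolution_powr_le:
  fixes A :: "nat \<Rightarrow> real"
  assumes "0 < \<theta>" "\<theta> < 1" "\<And>i. 0 < A i" "1 \<le> q"
  shows "(\<Sum>j<n. (\<Sum>l\<le>j. \<theta> ^ (j - l) * A l) powr q)
    \<le> (1 - \<theta>) powr (-q) * (\<Sum>j<n. A j powr q)"
proof (cases n)
  case (Suc m)
  define b where "b j = (\<Sum>l\<le>j. \<theta> ^ (j - l) * A l)" for j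
  define c where "c = (1 - \<theta>) powr (1 - q)"
  have b_Suc: "b (Suc j) = \<theta> * b j + A (Suc j)" for j
    by (simp add: b_def sum_distrib_left Suc_diff_le mult_ac)
  have b_pos: "0 < b j" for j
    unfolding b_def using assms by (intro sum_pos) auto
  have c: "1 \<le> c"
    using assms powr_mono'[of "1 - q" 0 "1 - \<theta>"] by (simp add: c_def)
  \<comment> \<open>The extra term \<theta> b_m^q is what the next step consumes: b_(m+1)^q splits
    into its shares 1 - \<theta> and \<theta>, and is itself at most \<theta> b_m^q plus the new
    term.\<close>
  have "(1 - \<theta>) * (\<Sum>j<Suc m. b j powr q) + \<theta> * b m powr q \<le> c * (\<Sum>j<Suc m. A j powr q)"
  proof (induction m)
    case 0
    have "A 0 powr q * 1 \<le> A 0 powr q * c" using c by (intro mult_left_mono) auto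
    then show ?case by (simp add: b_def algebra_simps)
  next
    case (Suc m)
    have "b (Suc m) powr q \<le> \<theta> * b m powr q + c * A (Suc m) powr q"
      unfolding b_Suc c_def using assms b_pos by (intro powr_geometric_step) auto
    then show ?case using Suc by (simp add: algebra_simps)
  qed
  moreover have "0 \<le> \<theta> * b m powr q" using assms by simp
  ultimately have "(1 - \<theta>) * (\<Sum>j<n. b j powr q) \<le> c * (\<Sum>j<n. A j powr q)"
    using Suc by simp
  then have "(\<Sum>j<n. b j powr q) \<le> (c / (1 - \<theta>)) * (\<Sum>j<n. A j powr q)"
    using assms by (simp add: field_simps)
  also have "c / (1 - \<theta>) = (1 - \<theta>) powr (-q)"
    using assms by (simp add: c_def powr_diff powr_minus divide_simps)
  finally show ?thesis by (simp add: b_def)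
qed simp

text \<open>Built from two geometric ratios: 2^(-s/q) from the low blocks, raised to the power -q by
  Young's inequality, and 2^(s/q - s/2) from the gap between the two high blocks. The summand 1
  accounts for the top block.\<close>

definition interp_const :: "real \<Rightarrow> real \<Rightarrow> real" where
  "interp_const q s = (1 + (1 - 2 powr (-s/q)) powr (-q)) / (1 - 2 powr (s/q - s/2))"

text \<open>All powers of T cancel except for the ratio T i / T j raised to s/q - s/2, which is a
  negative exponent because q > 2. What remains are geometric convolutions of the sequence
  A.\<close>

lemma dyadic_trilinear_sum_le:
  fixes A :: "nat \<Rightarrow> real"
  assumes q: "2 < q" and s: "0 < s" and T0: "0 < T0" and A: "\<And>i. 0 < A i"
  defines "T \<equiv> \<lambda>i. T0 * 2 ^ i"
  defines "M \<equiv> \<lambda>i. T i powr (s/q) * A i"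
  shows "(\<Sum>i<n. \<Sum>j\<le>i. T i powr (-s/2) * T j powr (-s/2) * (M i * M j) * (\<Sum>l\<le>j. M l) powr (q - 2))
    \<le> interp_const q s * (\<Sum>i<n. A i powr q)"
proof -
  define \<theta> where "\<theta> = (2::real) powr (-s/q)"
  define \<eta> where "\<eta> = (2::real) powr (s/q - s/2)"
  have th: "0 < \<theta>" "\<theta> < 1" using q s powr_less_one[of 2 "-s/q"] by (auto simp: \<theta>_def)
  have "s * 2 < s * q" using q s by (intro mult_strict_left_mono) auto
  then have et: "0 < \<eta>" "\<eta> < 1" using q s using powr_less_one[of 2 "s/q-s/2"] by (auto simp: \<eta>_def field_simps)
  define b where "b j = (\<Sum>l\<le>j. \<theta> ^ (j - l) * A l)" for j
  have b_pos: "0 < b j" for j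
    unfolding b_def using th A by (intro sum_pos) auto
  have Tpos: "0 < T i" for i using T0 by (simp add: T_def)
  have Tsplit: "T l powr e = T j powr e * (2 powr (-e)) ^ (j - l)" if "l \<le> j" for l j e
  proof -
    have "T l * 2 ^ (j - l) = T j"
      using that by (simp add: T_def flip: power_add)
    then have "T j powr e = T l powr e * (2 ^ (j - l)) powr e"
      using T0 by (metis powr_mult)
    also have "(2 ^ (j - l)) powr e = (2 powr e) ^ (j - l)"
      by (simp add: powr_realpow[symmetric] powr_powr mult.commute)
    finally show ?thesis
      by (simp add: powr_minus power_inverse field_simps)
  qed
  \<comment> \<open>The low blocks are dominated by the highest of them: relative to scale j the sum
    is a geometric average b j of the A l.\<close>
  have Msum: "(\<Sum>l\<le>j. M l) = T j powr (s/q) * b j" for j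
    unfolding b_def sum_distrib_left
  proof (intro sum.cong refl)
    fix l assume "l \<in> {..j}"
    then show "M l = T j powr (s/q) * (\<theta> ^ (j - l) * A l)"
      by (subst M_def, subst Tsplit[of l j "s/q"]) (auto simp: \<theta>_def)
  qed
  have term_le: "T i powr (-s/2) * T j powr (-s/2) * (M i * M j) * (\<Sum>l\<le>j. M l) powr (q - 2)
     \<le> \<eta> ^ (i - j) * (A i powr q + b j powr q)" if "j \<le> i" for i j
  proof -
    have "T i powr (-s/2) * T j powr (-s/2) * (M i * M j) * (\<Sum>l\<le>j. M l) powr (q - 2)
      = (T i powr (-s/2) * T i powr (s/q)) * (T j powr (-s/2) * T j powr (s/q) * T j powr ((s/q) * (q - 2)))
        * (A i * A j * b j powr (q - 2))"
    proof -
      have "(T j powr (s/q) * b j) powr (q - 2) = T j powr ((s/q) * (q - 2)) * b j powr (q - 2)"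
        by (simp only: powr_mult powr_powr)
      then show ?thesis unfolding Msum by (simp only: M_def mult_ac)
    qed
    also have "T i powr (-s/2) * T i powr (s/q) = T i powr (s/q - s/2)"
      by (simp flip: powr_add)
    also have "T j powr (-s/2) * T j powr (s/q) * T j powr ((s/q) * (q - 2)) = T j powr (s/2 - s/q)"
    proof -
      have "-s/2 + s/q + (s/q) * (q - 2) = s/2 - s/q" using q by (simp add: field_simps)
      then show ?thesis by (simp only: powr_add[symmetric])
    qed
    also have "T i powr (s/q - s/2) = T j powr (s/q - s/2) * \<eta> ^ (i - j)"
    proof -
      have "T j powr (s/q - s/2) = T i powr (s/q - s/2) * inverse \<eta> ^ (i - j)"
      proof -
        have "inverse \<eta> = 2 powr (-(s/q - s/2))" unfolding \<eta>_def by (rule powr_minus[symmetric])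
        then show ?thesis using Tsplit[OF that, of "s/q - s/2"] by simp
      qed
      then show ?thesis using et by (simp add: power_inverse field_simps)
    qed
    also have "T j powr (s/q - s/2) * \<eta> ^ (i - j) * T j powr (s/2 - s/q) = \<eta> ^ (i - j)"
      using Tpos[of j] by (simp add: mult_ac flip: powr_add)
    also have "A i * A j * b j powr (q - 2) \<le> A i powr q + b j powr q"
    proof -
      define m where "m = max (A i) (b j)"
      \<comment> \<open>The summand l = j of b j is A j itself. So the product has total degree q in
        A i and b j and is at most the q-th power of their maximum.\<close>
      have "A j \<le> b j"
        unfolding b_def using member_le_sum[of j "{..j}" "\<lambda>l. \<theta> ^ (j - l) * A l"] th less_imp_le[OF A]
        by simp
      then have "A i * A j * b j powr (q - 2) \<le> m * m * m powr (q - 2)"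
        using less_imp_le[OF A[of i]] less_imp_le[OF A[of j]] b_pos[of j] q
        by (intro mult_mono powr_mono2) (auto simp: m_def)
      also have "\<dots> = m powr q"
      proof -
        have "0 < m" using A[of i] by (simp add: m_def less_max_iff_disj)
        then show ?thesis by (simp add: powr_diff power2_eq_square)
      qed
      also have "\<dots> \<le> A i powr q + b j powr q"
        by (auto simp: m_def max_def)
      finally show ?thesis .
    qed
    finally show ?thesis using et by (simp add: mult_left_mono)
  qed
  have conv1: "(\<Sum>i<n. \<Sum>j\<le>i. \<eta> ^ (i - j) * x j) \<le> (1 / (1 - \<eta>)) * (\<Sum>i<n. x i)"
    if "\<And>i. 0 < x i" for x :: "nat \<Rightarrow> real"
  proof -
    have "0 \<le> (\<Sum>j\<le>i. \<eta> ^ (i - j) * x j)" for i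
      using et less_imp_le[OF that] by (intro sum_nonneg) auto
    then show ?thesis
      using sum_geometric_convolution_powr_le[of \<eta> x 1 n] et that less_imp_le[OF that]
      by (simp add: powr_minus divide_inverse)
  qed
  have geo: "(\<Sum>j\<le>i. \<eta> ^ (i - j)) \<le> 1 / (1 - \<eta>)" for i
  proof -
    have "(\<Sum>j\<le>i. \<eta> ^ (i - j)) = (\<Sum>j\<le>i. \<eta> ^ j)"
      by (rule sum.reindex_bij_witness[of _ "\<lambda>j. i - j" "\<lambda>j. i - j"]) auto
    also have "\<dots> \<le> 1 / (1 - \<eta>)"
      using et by (simp add: sum_gp0 divide_right_mono)
    finally show ?thesis .
  qed
  have "(\<Sum>i<n. \<Sum>j\<le>i. T i powr (-s/2) * T j powr (-s/2) * (M i * M j) * (\<Sum>l\<le>j. M l) powr (q - 2))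
    \<le> (\<Sum>i<n. \<Sum>j\<le>i. \<eta> ^ (i - j) * (A i powr q + b j powr q))"
    by (intro sum_mono term_le) auto
  also have "\<dots> = (\<Sum>i<n. A i powr q * (\<Sum>j\<le>i. \<eta> ^ (i - j))) + (\<Sum>i<n. \<Sum>j\<le>i. \<eta> ^ (i - j) * b j powr q)"
    by (simp add: sum.distrib sum_distrib_left algebra_simps)
  also have "\<dots> \<le> (\<Sum>i<n. A i powr q * (1 / (1 - \<eta>))) + (1 / (1 - \<eta>)) * (\<Sum>i<n. b i powr q)"
    using b_pos by (intro add_mono sum_mono mult_left_mono geo conv1) (auto simp: less_imp_neq[THEN not_sym])
  also have "\<dots> \<le> (\<Sum>i<n. A i powr q * (1 / (1 - \<eta>)))
      + (1 / (1 - \<eta>)) * ((1 - \<theta>) powr (-q) * (\<Sum>i<n. A i powr q))"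
    unfolding b_def using th et A q
    by (intro add_mono mult_left_mono order_refl sum_geometric_convolution_powr_le) auto
  also have "\<dots> = interp_const q s * (\<Sum>i<n. A i powr q)"
    using et by (simp add: interp_const_def \<theta>_def \<eta>_def flip: sum_divide_distrib)
       (simp add: add_divide_distrib algebra_simps)
  finally show ?thesis .
qed


section \<open>Integration of the pointwise inequality against the measure\<close>

text \<open>Cauchy-Schwarz from bounds on the square integrals. AM-GM weighted by v / u makes both
  halves contribute B u v / 2.\<close>

lemma nn_integral_mult_le_of_squares:
  fixes f g :: "'a \<Rightarrow> real"
  assumes [measurable]: "f \<in> borel_measurable M" "g \<in> borel_measurable M"
    and "0 < u" "0 < v" "0 \<le> B"
    and f: "(\<integral>\<^sup>+x. ennreal ((f x)\<^sup>2) \<partial>M) \<le> ennreal (B * u\<^sup>2)"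
    and g: "(\<integral>\<^sup>+x. ennreal ((g x)\<^sup>2) \<partial>M) \<le> ennreal (B * v\<^sup>2)"
  shows "(\<integral>\<^sup>+x. ennreal (f x * g x) \<partial>M) \<le> ennreal (B * (u * v))"
proof -
  have pt: "f x * g x \<le> v / (2 * u) * (f x)\<^sup>2 + u / (2 * v) * (g x)\<^sup>2" for x
  proof -
    have "0 \<le> (v * f x - u * g x)\<^sup>2 / (2 * u * v)" using assms by simp
    also have "\<dots> = v / (2 * u) * (f x)\<^sup>2 + u / (2 * v) * (g x)\<^sup>2 - f x * g x"
      using assms by (simp add: field_simps power2_eq_square)
    finally show ?thesis by simp
  qed
  have "(\<integral>\<^sup>+x. ennreal (f x * g x) \<partial>M)
      \<le> (\<integral>\<^sup>+x. ennreal (v / (2 * u)) * ennreal ((f x)\<^sup>2) + ennreal (u / (2 * v)) * ennreal ((g x)\<^sup>2) \<partial>M)"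
    using assms pt
    by (intro nn_integral_mono) (simp flip: ennreal_mult' ennreal_plus)
  also have "\<dots> = ennreal (v / (2 * u)) * (\<integral>\<^sup>+x. ennreal ((f x)\<^sup>2) \<partial>M)
      + ennreal (u / (2 * v)) * (\<integral>\<^sup>+x. ennreal ((g x)\<^sup>2) \<partial>M)"
    by (simp add: nn_integral_add nn_integral_cmult)
  also have "\<dots> \<le> ennreal (v / (2 * u)) * ennreal (B * u\<^sup>2) + ennreal (u / (2 * v)) * ennreal (B * v\<^sup>2)"
    using f g by (intro add_mono mult_left_mono) auto
  also have "\<dots> = ennreal (B * (u * v))"
    using assms by (simp flip: ennreal_mult' ennreal_plus) (simp add: field_simps power2_eq_square)
  finally show ?thesis .
qed

text \<open>The interpolation step in abstract form. The sup bound is inserted into the power q - 2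
  of the low sum before integrating, so that only products of two blocks remain under the integral,
  and these fall to Cauchy-Schwarz.\<close>

lemma nn_integral_dyadic_sum_powr_le:
  fixes g :: "nat \<Rightarrow> 'a \<Rightarrow> real" and A :: "nat \<Rightarrow> real"
  assumes q: "2 < q" and s: "0 < s" and T0: "0 < T0" and A: "\<And>i. 0 < A i"
    and c: "0 \<le> c" and B: "0 \<le> B"
  defines "T \<equiv> \<lambda>i. T0 * 2 ^ i"
  defines "M \<equiv> \<lambda>i. T i powr (s/q) * A i"
  assumes meas[measurable]: "\<And>i. g i \<in> borel_measurable \<mu>"
    and nonneg: "\<And>i x. 0 \<le> g i x"
    and sup: "\<And>i x. x \<in> space \<mu> \<Longrightarrow> g i x \<le> c * M i"
    and L2: "\<And>i. (\<integral>\<^sup>+x. ennreal ((g i x)\<^sup>2) \<partial>\<mu>) \<le> ennreal (B * (T i powr (-s) * (M i)\<^sup>2))"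
  shows "(\<integral>\<^sup>+x. ennreal ((\<Sum>i<n. g i x) powr q) \<partial>\<mu>)
    \<le> ennreal (q * (q - 1) * c powr (q - 2) * B * interp_const q s * (\<Sum>i<n. A i powr q))"
proof -
  define D where "D = q * (q - 1)"
  have D: "0 \<le> D" using q by (simp add: D_def)
  have Tpos: "0 < T i" for i using T0 by (simp add: T_def)
  have Mpos: "0 < M i" for i using A Tpos[of i] by (simp add: M_def)
  define E where "E i j = T i powr (-s/2) * T j powr (-s/2) * (M i * M j)" for i j
  define R where "R j = (\<Sum>l\<le>j. M l) powr (q - 2)" for j
  have ER: "0 \<le> E i j" "0 \<le> R j" for i j
    using less_imp_le[OF Mpos] by (auto simp: E_def R_def)
  have prod_le: "(\<integral>\<^sup>+x. ennreal (g i x * g j x) \<partial>\<mu>) \<le> ennreal (B * E i j)" for i j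
  proof -
    have *: "T i powr (-s) * (M i)\<^sup>2 = (T i powr (-s/2) * M i)\<^sup>2" for i
      by (simp add: power_mult_distrib power2_eq_square flip: powr_add)
    have "(\<integral>\<^sup>+x. ennreal (g i x * g j x) \<partial>\<mu>)
        \<le> ennreal (B * ((T i powr (-s/2) * M i) * (T j powr (-s/2) * M j)))"
      using L2[of i] L2[of j] B Tpos[of i] Tpos[of j] Mpos[of i] Mpos[of j] unfolding *
      by (intro nn_integral_mult_le_of_squares) (auto simp: *)
    then show ?thesis by (simp add: E_def mult_ac)
  qed
  have "(\<integral>\<^sup>+x. ennreal ((\<Sum>i<n. g i x) powr q) \<partial>\<mu>)
      \<le> (\<integral>\<^sup>+x. (\<Sum>i<n. \<Sum>j\<le>i. ennreal (D * c powr (q - 2) * R j) * ennreal (g i x * g j x)) \<partial>\<mu>)"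
  proof (intro nn_integral_mono)
    fix x assume x: "x \<in> space \<mu>"
    have S_le: "(\<Sum>l\<le>j. g l x) powr (q - 2) \<le> c powr (q - 2) * R j" for j
    proof -
      have "(\<Sum>l\<le>j. g l x) powr (q - 2) \<le> (c * (\<Sum>l\<le>j. M l)) powr (q - 2)"
        unfolding sum_distrib_left using q nonneg sup[OF x] by (intro powr_mono2 sum_mono sum_nonneg) auto
      then show ?thesis by (simp add: R_def powr_mult)
    qed
    have "(\<Sum>i<n. g i x) powr q
        \<le> D * (\<Sum>i<n. \<Sum>j\<le>i. g i x * g j x * (\<Sum>l\<le>j. g l x) powr (q - 2))"
      unfolding D_def using nonneg q by (intro sum_powr_le_double_sum) auto
    also have "\<dots> \<le> D * (\<Sum>i<n. \<Sum>j\<le>i. g i x * g j x * (c powr (q - 2) * R j))"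
      using nonneg D S_le by (intro mult_left_mono sum_mono) auto
    also have "\<dots> = (\<Sum>i<n. \<Sum>j\<le>i. D * c powr (q - 2) * R j * (g i x * g j x))"
      by (simp add: sum_distrib_left mult_ac)
    finally have "ennreal ((\<Sum>i<n. g i x) powr q) \<le> ennreal \<dots>" by (rule ennreal_leI)
    also have "\<dots> = (\<Sum>i<n. \<Sum>j\<le>i. ennreal (D * c powr (q - 2) * R j) * ennreal (g i x * g j x))"
      using nonneg D ER by (simp add: sum_nonneg flip: sum_ennreal ennreal_mult')
    finally show "ennreal ((\<Sum>i<n. g i x) powr q) \<le> \<dots>" .
  qed
  also have "\<dots> = (\<Sum>i<n. \<Sum>j\<le>i. ennreal (D * c powr (q - 2) * R j) * (\<integral>\<^sup>+x. ennreal (g i x * g j x) \<partial>\<mu>))"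
    by (simp add: nn_integral_sum nn_integral_cmult)
  also have "\<dots> \<le> (\<Sum>i<n. \<Sum>j\<le>i. ennreal (D * c powr (q - 2) * R j) * ennreal (B * E i j))"
    by (intro sum_mono mult_left_mono prod_le) auto
  also have "\<dots> = ennreal (\<Sum>i<n. \<Sum>j\<le>i. D * c powr (q - 2) * R j * (B * E i j))"
    using D B ER by (simp add: sum_nonneg flip: sum_ennreal ennreal_mult')
  also have "(\<Sum>i<n. \<Sum>j\<le>i. D * c powr (q - 2) * R j * (B * E i j))
      = D * c powr (q - 2) * B * (\<Sum>i<n. \<Sum>j\<le>i. E i j * R j)"
    by (simp add: sum_distrib_left mult_ac)
  also have "ennreal \<dots> \<le> ennreal (D * c powr (q - 2) * B * (interp_const q s * (\<Sum>i<n. A i powr q)))"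
    unfolding E_def R_def T_def M_def using D B
    by (intro ennreal_leI mult_left_mono dyadic_trilinear_sum_le[OF q s T0 A]) auto
  finally show ?thesis by (simp add: D_def mult.assoc)
qed

section \<open>The kernel of the dual transform\<close>

lemma tendsto_power_mult_exp_neg:
  fixes c :: complex
  assumes "0 < Re c"
  shows "((\<lambda>t. of_real t ^ n * exp (- c * of_real t)) \<longlongrightarrow> 0) at_top"
proof -
  have "((\<lambda>x::real. x ^ n / exp x) \<longlongrightarrow> 0) at_top"
    by (rule tendsto_power_div_exp_0)
  moreover have "filterlim (\<lambda>t. Re c * t) at_top at_top"
    using assms by (rule filterlim_tendsto_pos_mult_at_top[OF tendsto_const _ filterlim_ident])
  ultimately have "((\<lambda>t. (Re c * t) ^ n / exp (Re c * t)) \<longlongrightarrow> 0) at_top"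
    by (rule filterlim_compose)
  then have "((\<lambda>t. (1 / Re c ^ n) * ((Re c * t) ^ n / exp (Re c * t))) \<longlongrightarrow> (1 / Re c ^ n) * 0) at_top"
    by (intro tendsto_intros)
  then have *: "((\<lambda>t. t ^ n * exp (- (Re c * t))) \<longlongrightarrow> 0) at_top"
    using assms by (simp add: power_mult_distrib exp_minus field_simps)
  have "((\<lambda>t. norm (complex_of_real t ^ n * exp (- c * of_real t))) \<longlongrightarrow> 0) at_top"
  proof (rule Lim_transform_eventually[OF *])
    show "eventually (\<lambda>t. t ^ n * exp (- (Re c * t)) = norm (complex_of_real t ^ n * exp (- c * of_real t))) at_top"
      using eventually_ge_at_top[of 0] by eventually_elim (simp add: norm_mult norm_power)
  qed
  then show ?thesis by (rule tendsto_norm_zero_cancel)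
qed

text \<open>The modulus depends on c only through Re c, so the Gamma integral at n + 1 with real
  rate Re c dominates.\<close>

lemma set_integrable_power_mult_exp_neg:
  fixes c :: complex
  assumes "0 < Re c"
  shows "set_integrable lborel {0<..} (\<lambda>t. of_real t ^ n * exp (- c * of_real t))"
proof -
  have "(\<lambda>t. complex_of_real t powr (of_nat (Suc n) - 1) / of_real (exp (Re c * t)))
      absolutely_integrable_on {0<..}"
    using assms by (intro absolutely_integrable_Gamma_integral) auto
  also have "?this \<longleftrightarrow> set_integrable lebesgue {0<..} (\<lambda>t. complex_of_real t ^ n * of_real (exp (- (Re c * t))))"
    by (intro set_integrable_cong refl) (auto simp: powr_nat exp_minus field_simps)
  finally have "set_integrable lborel {0<..} (\<lambda>t. complex_of_real t ^ n * of_real (exp (- (Re c * t))))"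
    unfolding set_integrable_def by (subst (asm) integrable_completion) auto
  then show ?thesis
    unfolding set_integrable_def
  proof (rule Bochner_Integration.integrable_bound)
    show "AE t in lborel. norm (indicat_real {0<..} t *\<^sub>R (of_real t ^ n * exp (- c * of_real t)))
      \<le> norm (indicat_real {0<..} t *\<^sub>R (complex_of_real t ^ n * of_real (exp (- (Re c * t)))))"
      by (intro AE_I2) (auto simp: indicator_def norm_mult norm_power)
  qed measurable
qed

text \<open>Euler's integral for Gamma(n + 1) with a complex rate. The recursion in n is integration
  by parts: the derivative of t^(n+1) e^(-ct) integrates to 0, since both boundary values
  vanish.\<close>

lemma LBINT_power_mult_exp_neg:
  fixes c :: complex
  assumes "0 < Re c"
  shows "(LBINT t:{0<..}. of_real t ^ n * exp (- c * of_real t)) = fact n / c ^ Suc n"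
proof (induction n)
  have c: "c \<noteq> 0" using assms by auto
  case 0
  have "(LBINT t=0..\<infinity>. exp (- c * of_real t)) = 0 - (- 1 / c)"
  proof (rule interval_integral_FTC_integrable[where F = "\<lambda>t. - exp (- c * of_real t) / c"])
    show "set_integrable lborel (einterval 0 \<infinity>) (\<lambda>t. exp (- c * of_real t))"
      using set_integrable_power_mult_exp_neg[OF assms, of 0] by (simp add: zero_ereal_def)
    show "(((\<lambda>t. - exp (- c * of_real t) / c) \<circ> real_of_ereal) \<longlongrightarrow> - 1 / c) (at_right 0)"
      using c unfolding zero_ereal_def ereal_tendsto_simps
      by (auto intro!: tendsto_eq_intros)
    show "(((\<lambda>t. - exp (- c * of_real t) / c) \<circ> real_of_ereal) \<longlongrightarrow> 0) (at_left \<infinity>)"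
      using c tendsto_divide[OF tendsto_minus[OF tendsto_power_mult_exp_neg[OF assms, of 0]] tendsto_const[of c]]
      unfolding ereal_tendsto_simps by simp
    show "((\<lambda>t. - exp (- c * of_real t) / c) has_vector_derivative exp (- c * of_real x)) (at x)" for x
      using c by (auto intro!: derivative_eq_intros has_vector_derivative_real_field)
  qed (auto intro!: continuous_intros)
  then show ?case by (simp add: interval_lebesgue_integral_0_infty)
next
  case (Suc n)
  have c: "c \<noteq> 0" using assms by auto
  let ?f = "\<lambda>n t. complex_of_real t ^ n * exp (- c * of_real t)"
  note int = set_integrable_power_mult_exp_neg[OF assms]
  have "(LBINT t=0..\<infinity>. of_nat (Suc n) * ?f n t - c * ?f (Suc n) t) = 0 - 0"
  proof (rule interval_integral_FTC_integrable[where F = "?f (Suc n)"])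
    show "set_integrable lborel (einterval 0 \<infinity>) (\<lambda>t. of_nat (Suc n) * ?f n t - c * ?f (Suc n) t)"
      using int[of n] int[of "Suc n"]
      by (auto simp: zero_ereal_def simp del: power_Suc of_nat_Suc intro!: set_integral_diff set_integrable_mult_right)
    show "((?f (Suc n) \<circ> real_of_ereal) \<longlongrightarrow> 0) (at_right 0)"
      unfolding zero_ereal_def ereal_tendsto_simps by (auto intro!: tendsto_eq_intros)
    show "((?f (Suc n) \<circ> real_of_ereal) \<longlongrightarrow> 0) (at_left \<infinity>)"
      using tendsto_power_mult_exp_neg[OF assms, of "Suc n"] unfolding ereal_tendsto_simps .
    show "(?f (Suc n) has_vector_derivative of_nat (Suc n) * ?f n x - c * ?f (Suc n) x) (at x)" for x
      by (rule has_vector_derivative_real_field)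
         (auto intro!: derivative_eq_intros simp: algebra_simps simp del: power_Suc)
  qed (auto intro!: continuous_intros)
  then have "(LBINT t:{0<..}. of_nat (Suc n) * ?f n t - c * ?f (Suc n) t) = 0"
    by (simp add: interval_lebesgue_integral_0_infty)
  then have "of_nat (Suc n) * (LBINT t:{0<..}. ?f n t) - c * (LBINT t:{0<..}. ?f (Suc n) t) = 0"
    using int[of n] int[of "Suc n"]
    by (subst (asm) set_integral_diff(2)) (auto simp del: power_Suc of_nat_Suc)
  then have "(LBINT t:{0<..}. ?f (Suc n) t) = of_nat (Suc n) * (LBINT t:{0<..}. ?f n t) / c"
    using c by (simp only: eq_divide_eq) (simp del: power_Suc of_nat_Suc add: mult.commute)
  also have "\<dots> = fact (Suc n) / c ^ Suc (Suc n)"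
    unfolding Suc by simp
  finally show ?case .
qed


section \<open>Waves, the majorant of a block, and the resulting kernel\<close>

text \<open>The Laplace kernel, cut off at t \<le> 0, where it would grow on the half-plane.
  Integrals then run over the whole line and the uniform bound 1 holds for every t.\<close>

definition wave :: "real \<Rightarrow> complex \<Rightarrow> complex" where
  "wave t z = (if 0 < t then exp (2 * of_real pi * \<i> * of_real t * z) else 0)"

lemma norm_wave_le_1: "0 \<le> Im z \<Longrightarrow> norm (wave t z) \<le> 1"
  by (auto simp: wave_def mult_nonneg_nonneg)

lemma measurable_cnj[measurable]: "cnj \<in> borel_measurable borel"
  by (intro borel_measurable_continuous_onI continuous_intros)

text \<open>The hypothesis on the identity stands for any sigma-algebra on points of the plane that
  is fine enough, such as the trace on the half-plane, where \<open>\<mu>\<close> and its densities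
  live.\<close>

lemma measurable_wave:
  assumes id: "(\<lambda>z. z) \<in> borel_measurable M"
    and [measurable]: "f \<in> borel_measurable N" "g \<in> N \<rightarrow>\<^sub>M M"
  shows "(\<lambda>x. wave (f x) (g x)) \<in> borel_measurable N"
proof -
  have [measurable]: "g \<in> borel_measurable N"
    using measurable_compose[OF assms(3) id] by simp
  show ?thesis unfolding wave_def by measurable
qed

text \<open>Dominates the indicator of [T, 2T] but, unlike it, has an explicit Laplace transform
  with decay of order m + 1. The factor exp (4 pi) offsets the exponential at t = 2T.\<close>

definition majorant :: "nat \<Rightarrow> real \<Rightarrow> real \<Rightarrow> real" where
  "majorant m T t = (if 0 < t then exp (4 * pi) * (t / T) ^ m * exp (- (2 * pi * t / T)) else 0)"

lemma majorant_nonneg: "0 < T \<Longrightarrow> 0 \<le> majorant m T t"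
  by (simp add: majorant_def)

lemma majorant_ge_1:
  assumes "0 < T" "T \<le> t" "t \<le> 2 * T"
  shows "1 \<le> majorant m T t"
proof -
  have "2 * pi * t / T \<le> 4 * pi" using assms by (simp add: field_simps)
  then have "1 \<le> exp (4 * pi + - (2 * pi * t / T))" by (subst one_le_exp_iff) linarith
  moreover have "1 \<le> (t / T) ^ m" using assms by (intro one_le_power) auto
  ultimately have "1 * 1 \<le> (t / T) ^ m * exp (4 * pi + - (2 * pi * t / T))"
    by (intro mult_mono) auto
  then show ?thesis using assms unfolding exp_add by (simp add: majorant_def mult_ac)
qed

lemma measurable_majorant[measurable]: "majorant m T \<in> borel_measurable borel"
  unfolding majorant_def[abs_def] by measurable

lemma majorant_wave_eq:
  assumes "0 < T"
  shows "of_real (majorant m T t) * wave t z * cnj (wave t w) =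
    (of_real (exp (4 * pi)) / of_real T ^ m) *
    (indicator {0<..} t *\<^sub>R (of_real t ^ m * exp (- (2 * of_real pi * (1 / of_real T - \<i> * (z - cnj w))) * of_real t)))"
  using assms by (auto simp: majorant_def wave_def exp_cnj power_divide field_simps
      simp flip: exp_of_real exp_add)

text \<open>Since 1/T - i(z - cnj w) = -i(z + i/T - cnj w), this is, up to a constant, the modulus
  of the Szego kernel of the half-plane to the power m + 1, with z raised by 1/T.\<close>

definition schur_kernel :: "nat \<Rightarrow> real \<Rightarrow> complex \<Rightarrow> complex \<Rightarrow> real" where
  "schur_kernel m T z w = 1 / norm (1 / of_real T - \<i> * (z - cnj w)) ^ Suc m"

lemma measurable_schur_kernel:
  assumes id: "(\<lambda>z. z) \<in> borel_measurable M"
    and [measurable]: "f \<in> N \<rightarrow>\<^sub>M M" "g \<in> N \<rightarrow>\<^sub>M M"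
  shows "(\<lambda>x. schur_kernel m T (f x) (g x)) \<in> borel_measurable N"
proof -
  have [measurable]: "f \<in> borel_measurable N" "g \<in> borel_measurable N"
    using measurable_compose[OF assms(2) id] measurable_compose[OF assms(3) id] by simp_all
  show ?thesis unfolding schur_kernel_def by measurable
qed

lemma schur_kernel_commute: "schur_kernel m T z w = schur_kernel m T w z"
proof -
  have "norm (1 / of_real T - \<i> * (z - cnj w)) = norm (cnj (1 / of_real T - \<i> * (z - cnj w)))"
    by (rule complex_mod_cnj[symmetric])
  also have "cnj (1 / of_real T - \<i> * (z - cnj w)) = 1 / of_real T - \<i> * (w - cnj z)"
    by (simp add: algebra_simps)
  finally show ?thesis by (simp add: schur_kernel_def)
qed

lemma integrable_majorant: "0 < T \<Longrightarrow> integrable lborel (majorant m T)"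
proof -
  assume T: "0 < T"
  \<comment> \<open>At z = w = 0 both waves equal 1 wherever the majorant is nonzero.\<close>
  have "integrable lborel (\<lambda>t. of_real (majorant m T t) * wave t 0 * cnj (wave t 0))"
    unfolding majorant_wave_eq[OF T]
    using set_integrable_power_mult_exp_neg[of "2 * of_real pi * (1 / of_real T - \<i> * (0 - cnj 0))" m] T
    unfolding set_integrable_def by (intro integrable_mult_right) (auto simp: field_simps)
  also have "(\<lambda>t. of_real (majorant m T t) * wave t 0 * cnj (wave t 0)) = (\<lambda>t. complex_of_real (majorant m T t))"
    by (auto simp: fun_eq_iff wave_def majorant_def)
  finally show ?thesis using integrable_Re by fastforce
qed

text \<open>The kernel of the \<open>TT\<^sup>*\<close> operator with the majorant as weight. It is
  Euler's integral at c = 2 pi d; the gain (2 pi)^(-(m+1)) is given away. The real part 1/T + Im z +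
  Im w of d keeps the integral convergent.\<close>

lemma norm_LBINT_majorant_wave_le:
  assumes "0 < T" "0 < Im z" "0 < Im w"
  shows "norm (LBINT t. of_real (majorant m T t) * wave t z * cnj (wave t w))
    \<le> exp (4 * pi) * fact m / T ^ m * schur_kernel m T z w"
proof -
  define d where "d = 1 / complex_of_real T - \<i> * (z - cnj w)"
  define c where "c = 2 * of_real pi * d"
  have Red: "Re d = 1 / T + (Im z + Im w)" by (simp add: d_def)
  have Rec: "0 < Re c" using assms Red by (simp add: c_def add_pos_pos)
  have d: "d \<noteq> 0" using assms Red by (metis add_pos_pos less_irrefl zero_complex.sel(1) zero_less_divide_1_iff)
  have "(LBINT t. of_real (majorant m T t) * wave t z * cnj (wave t w))
    = (of_real (exp (4 * pi)) / of_real T ^ m) * (fact m / c ^ Suc m)"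
    unfolding majorant_wave_eq[OF assms(1)] integral_mult_right_zero
    using LBINT_power_mult_exp_neg[OF Rec, of m]
    by (simp only: set_lebesgue_integral_def c_def d_def)
  also have "norm \<dots> = exp (4 * pi) * fact m / T ^ m * (1 / norm c ^ Suc m)"
    using assms by (simp add: norm_mult norm_divide norm_power del: power_Suc)
  also have "\<dots> \<le> exp (4 * pi) * fact m / T ^ m * (1 / norm d ^ Suc m)"
  proof -
    have "norm d \<le> norm c"
      using pi_gt3 by (simp add: c_def norm_mult mult_le_cancel_right1)
    then have "norm d ^ Suc m \<le> norm c ^ Suc m" by (rule power_mono) auto
    then show ?thesis using assms d
      by (intro mult_left_mono divide_left_mono) (auto simp: c_def)
  qed
  finally show ?thesis by (simp add: schur_kernel_def d_def)
qed

section \<open>The square-integral estimate over Carleson boxes\<close>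

text \<open>No integrability is asked for, because the Bochner integral of a non-integrable function
  is 0.\<close>

lemma ennreal_norm_integral_le_nn_integral:
  fixes f :: "'a \<Rightarrow> 'b::{banach, second_countable_topology}"
  shows "ennreal (norm (integral\<^sup>L M f)) \<le> (\<integral>\<^sup>+x. ennreal (norm (f x)) \<partial>M)"
  by (cases "integrable M f") (auto simp: not_integrable_integral_eq integral_norm_bound_ennreal)

text \<open>A dominating function of t alone is integrable on the product because the other measure
  is finite. This is why the square estimate is first proved for finite measures.\<close>

lemma (in finite_measure) integral_lborel_swap:
  fixes g :: "'a \<Rightarrow> real \<Rightarrow> complex"
  assumes meas[measurable]: "(\<lambda>(z, t). g z t) \<in> borel_measurable (M \<Otimes>\<^sub>M lborel)"
    and h: "integrable lborel h" and le: "\<And>z t. z \<in> space M \<Longrightarrow> norm (g z t) \<le> h t"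
  shows "(\<integral>z. (LBINT t. g z t) \<partial>M) = (LBINT t. (\<integral>z. g z t \<partial>M))"
proof -
  interpret pair_sigma_finite M lborel ..
  have [measurable]: "h \<in> borel_measurable lborel" using h by auto
  have "integrable (M \<Otimes>\<^sub>M lborel) (\<lambda>(z, t). g z t)"
  proof (rule integrableI_bounded)
    have "(\<integral>\<^sup>+p. ennreal (norm (case p of (z, t) \<Rightarrow> g z t)) \<partial>(M \<Otimes>\<^sub>M lborel))
        = (\<integral>\<^sup>+z. \<integral>\<^sup>+t. ennreal (norm (g z t)) \<partial>lborel \<partial>M)"
      by (subst lborel.nn_integral_fst[symmetric]) auto
    also have "\<dots> \<le> (\<integral>\<^sup>+z. \<integral>\<^sup>+t. ennreal (norm (h t)) \<partial>lborel \<partial>M)"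
      using order_trans[OF le abs_ge_self] by (intro nn_integral_mono ennreal_leI) auto
    also have "\<dots> = (\<integral>\<^sup>+t. ennreal (norm (h t)) \<partial>lborel) * emeasure M (space M)"
      by simp
    also have "\<dots> < \<infinity>"
    proof -
      have "emeasure M (space M) < top" by (simp add: less_top[symmetric])
      then show ?thesis using h by (auto simp: integrable_iff_bounded ennreal_mult_less_top)
    qed
    finally show "(\<integral>\<^sup>+p. ennreal (norm (case p of (z, t) \<Rightarrow> g z t)) \<partial>(M \<Otimes>\<^sub>M lborel)) < \<infinity>" .
  qed auto
  then show ?thesis by (rule Fubini_integral[symmetric])
qed

text \<open>
  The \<open>TT\<^sup>*\<close> argument. Writing \<open>A\<close> for the left-hand side and \<open>h\<close> for the adjoint transform of
  \<open>F\<close>, one has \<open>A = \<integral> f h\<close>, while the Schur test bounds \<open>\<integral> \<phi> |h|\<^sup>2\<close> by \<open>B A\<close> for the majorant \<open>\<phi>\<close>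
  of the indicator of \<open>[T, 2 T]\<close>; hence \<open>A \<le> B/2 \<integral> |f|\<^sup>2 + A/2\<close>.
\<close>

lemma nn_integral_wave_transform_finite:
  fixes \<nu> :: "complex measure" and f :: "real \<Rightarrow> complex"
  assumes fin: "finite_measure \<nu>"
    and id: "(\<lambda>z. z) \<in> borel_measurable \<nu>"
    and Im: "\<And>z. z \<in> space \<nu> \<Longrightarrow> 0 < Im z"
    and f1: "integrable lborel f"
    and f2: "integrable lborel (\<lambda>t. (norm (f t))\<^sup>2)"
    and supp: "\<And>t. f t \<noteq> 0 \<Longrightarrow> T \<le> t \<and> t \<le> 2 * T"
    and T: "0 < T" and B: "0 < B"
    and schur: "\<And>z. z \<in> space \<nu> \<Longrightarrow>
      (\<integral>\<^sup>+w. ennreal (exp (4 * pi) * fact m / T ^ m * schur_kernel m T z w) \<partial>\<nu>) \<le> ennreal B"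
  shows "(\<integral>\<^sup>+z. ennreal ((norm (LBINT t. f t * wave t z))\<^sup>2) \<partial>\<nu>)
    \<le> ennreal (B * (LBINT t. (norm (f t))\<^sup>2))"
proof -
  interpret finite_measure \<nu> by fact
  note [measurable] = measurable_wave[OF id] measurable_schur_kernel[OF id]
  have [measurable]: "f \<in> borel_measurable borel" using f1 by auto
  define \<phi> where "\<phi> = majorant m T"
  have [measurable]: "\<phi> \<in> borel_measurable borel" by (simp add: \<phi>_def)
  have phi0: "0 \<le> \<phi> t" for t using T by (simp add: \<phi>_def majorant_nonneg)
  have phi_int: "integrable lborel \<phi>" unfolding \<phi>_def using T by (rule integrable_majorant)
  define F where "F z = (LBINT t. f t * wave t z)" for z
  have F_meas[measurable]: "F \<in> borel_measurable \<nu>"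
    unfolding F_def by measurable
  define N where "N = (LBINT t. norm (f t))"
  have wave1: "norm (wave t z) \<le> 1" if "z \<in> space \<nu>" for t z
    using Im[OF that] by (intro norm_wave_le_1) auto
  have N0: "0 \<le> N" by (simp add: N_def)
  have F_le: "norm (F z) \<le> N" if "z \<in> space \<nu>" for z
  proof -
    have "norm (F z) \<le> (LBINT t. norm (f t * wave t z))" unfolding F_def by simp
    also have "\<dots> \<le> N"
      unfolding N_def using f1 wave1[OF that]
      by (intro integral_mono' integrable_norm) (auto simp: norm_mult mult_left_le)
    finally show ?thesis .
  qed
  \<comment> \<open>F is bounded by the \<open>L^1\<close> norm of f and \<open>\<nu>\<close> is
    finite, so A is known to be a real number beforehand; the final absorption of A / 2 rests on
    this.\<close>
  have F2_int: "integrable \<nu> (\<lambda>z. (norm (F z))\<^sup>2)"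
    using F_le N0 by (intro integrable_const_bound[where B = "N\<^sup>2"] AE_I2) (auto intro!: power_mono)
  define A where "A = (\<integral>z. (norm (F z))\<^sup>2 \<partial>\<nu>)"
  have A_nn: "(\<integral>\<^sup>+z. ennreal ((norm (F z))\<^sup>2) \<partial>\<nu>) = ennreal A"
    unfolding A_def by (rule nn_integral_eq_integral[OF F2_int]) auto
  have A0: "0 \<le> A" by (simp add: A_def)
  define h where "h t = (\<integral>z. cnj (F z) * wave t z \<partial>\<nu>)" for t
  have h_meas[measurable]: "h \<in> borel_measurable borel"
    unfolding h_def by measurable
  have h_le: "norm (h t) \<le> N * measure \<nu> (space \<nu>)" for t
  proof -
    have "norm (h t) \<le> (\<integral>z. norm (cnj (F z) * wave t z) \<partial>\<nu>)" unfolding h_def by simp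
    also have "\<dots> \<le> (\<integral>z. N \<partial>\<nu>)"
      using F_le wave1 N0 by (intro integral_mono') (auto simp: norm_mult mult_le_one intro: mult_mono[of _ N _ 1, simplified])
    finally show ?thesis by (simp add: mult.commute)
  qed
  have A_eq: "of_real A = (LBINT t. f t * h t)"
  proof -
    have "complex_of_real A = (\<integral>z. of_real ((norm (F z))\<^sup>2) \<partial>\<nu>)"
      unfolding A_def by (simp del: of_real_power)
    also have "\<dots> = (\<integral>z. (LBINT t. cnj (F z) * (f t * wave t z)) \<partial>\<nu>)"
      by (intro Bochner_Integration.integral_cong refl) (simp only: integral_mult_right_zero F_def[symmetric] complex_norm_square mult.commute)
    also have "\<dots> = (LBINT t. (\<integral>z. cnj (F z) * (f t * wave t z) \<partial>\<nu>))"
    proof (rule integral_lborel_swap)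
      show "integrable lborel (\<lambda>t. N * norm (f t))" using f1 by auto
      show "norm (cnj (F z) * (f t * wave t z)) \<le> N * norm (f t)" if "z \<in> space \<nu>" for z t
        using F_le[OF that] wave1[OF that, of t] N0
        by (auto simp: norm_mult intro!: mult_mono mult_left_le)
    qed measurable
    also have "\<dots> = (LBINT t. f t * h t)"
      unfolding h_def by (simp flip: integral_mult_right_zero add: mult_ac)
    finally show ?thesis .
  qed
  have dual_int: "integrable lborel (\<lambda>t. \<phi> t * (norm (h t))\<^sup>2)"
  proof (rule Bochner_Integration.integrable_bound)
    show "integrable lborel (\<lambda>t. \<phi> t * (N * measure \<nu> (space \<nu>))\<^sup>2)" using phi_int by auto
    show "AE t in lborel. norm (\<phi> t * (norm (h t))\<^sup>2) \<le> norm (\<phi> t * (N * measure \<nu> (space \<nu>))\<^sup>2)"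
      using phi0 h_le by (intro AE_I2) (auto simp: abs_mult intro!: mult_left_mono power_mono)
  qed measurable
  define D where "D = (LBINT t. \<phi> t * (norm (h t))\<^sup>2)"
  define k where "k z w = (LBINT t. of_real (\<phi> t) * wave t z * cnj (wave t w))" for z w
  define \<kappa> where "\<kappa> z w = exp (4 * pi) * fact m / T ^ m * schur_kernel m T z w" for z w
  have \<kappa>_meas[measurable]: "(\<lambda>x. \<kappa> (g1 x) (g2 x)) \<in> borel_measurable N"
    if [measurable]: "g1 \<in> N \<rightarrow>\<^sub>M \<nu>" "g2 \<in> N \<rightarrow>\<^sub>M \<nu>" for N :: "'b measure" and g1 g2
    unfolding \<kappa>_def by measurable
  have \<kappa>_meas1: "(\<lambda>z. \<kappa> z w) \<in> borel_measurable \<nu>" "(\<lambda>z. \<kappa> w z) \<in> borel_measurable \<nu>"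
    if "w \<in> space \<nu>" for w
    using that unfolding \<kappa>_def by (auto intro!: borel_measurable_times measurable_schur_kernel[OF id])
  have k_le: "norm (k z w) \<le> \<kappa> z w" if "z \<in> space \<nu>" "w \<in> space \<nu>" for z w
    unfolding k_def \<phi>_def \<kappa>_def using that by (intro norm_LBINT_majorant_wave_le T Im)
  \<comment> \<open>Expanding \<open>|h|^2\<close> and moving the t-integral inside past w and then
    past z turns D into the quadratic form of k at F. Integrability of \<phi> and finiteness of
    \<open>\<nu>\<close> justify both exchanges.\<close>
  have D_eq: "of_real D = (\<integral>w. F w * (\<integral>z. cnj (F z) * k z w \<partial>\<nu>) \<partial>\<nu>)"
  proof -
    have "complex_of_real D = (LBINT t. of_real (\<phi> t * (norm (h t))\<^sup>2))"
      unfolding D_def by (simp del: of_real_power of_real_mult)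
    also have "\<dots> = (LBINT t. (\<integral>w. of_real (\<phi> t) * h t * (F w * cnj (wave t w)) \<partial>\<nu>))"
    proof (intro Bochner_Integration.integral_cong refl)
      fix t
      have "cnj (h t) = (\<integral>w. F w * cnj (wave t w) \<partial>\<nu>)"
        unfolding h_def by (subst Bochner_Integration.integral_cnj[symmetric]) (simp only: complex_cnj_mult complex_cnj_cnj)
      then show "of_real (\<phi> t * (norm (h t))\<^sup>2) = (\<integral>w. of_real (\<phi> t) * h t * (F w * cnj (wave t w)) \<partial>\<nu>)"
        by (simp add: complex_norm_square mult.assoc del: of_real_power)
    qed
    also have "\<dots> = (\<integral>w. (LBINT t. of_real (\<phi> t) * h t * (F w * cnj (wave t w))) \<partial>\<nu>)"
    proof (rule integral_lborel_swap[symmetric])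
      show "integrable lborel (\<lambda>t. \<phi> t * (N * measure \<nu> (space \<nu>)) * N)" using phi_int by auto
      show "norm (of_real (\<phi> t) * h t * (F w * cnj (wave t w))) \<le> \<phi> t * (N * measure \<nu> (space \<nu>)) * N"
        if "w \<in> space \<nu>" for w t
      proof -
        have "norm (F w) * norm (wave t w) \<le> N * 1"
          using F_le[OF that] wave1[OF that, of t] N0 by (intro mult_mono) auto
        then show ?thesis using phi0[of t] h_le[of t] N0
          unfolding norm_mult by (intro mult_mono) auto
      qed
    qed measurable
    also have "\<dots> = (\<integral>w. F w * (LBINT t. (\<integral>z. of_real (\<phi> t) * cnj (wave t w) * (cnj (F z) * wave t z) \<partial>\<nu>)) \<partial>\<nu>)"
      unfolding h_def by (simp flip: integral_mult_right_zero add: mult_ac)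
    also have "\<dots> = (\<integral>w. F w * (\<integral>z. cnj (F z) * k z w \<partial>\<nu>) \<partial>\<nu>)"
    proof (intro Bochner_Integration.integral_cong refl arg_cong2[where f = "(*)"])
      fix w assume w: "w \<in> space \<nu>"
      have "(LBINT t. (\<integral>z. of_real (\<phi> t) * cnj (wave t w) * (cnj (F z) * wave t z) \<partial>\<nu>))
        = (\<integral>z. (LBINT t. of_real (\<phi> t) * cnj (wave t w) * (cnj (F z) * wave t z)) \<partial>\<nu>)"
      proof (rule integral_lborel_swap[symmetric])
        show "integrable lborel (\<lambda>t. \<phi> t * N)" using phi_int by auto
        show "norm (of_real (\<phi> t) * cnj (wave t w) * (cnj (F z) * wave t z)) \<le> \<phi> t * N"
          if "z \<in> space \<nu>" for z t
        proof -
          have "norm (F z) * norm (wave t z) \<le> N * 1"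
            using F_le[OF that] wave1[OF that, of t] N0 by (intro mult_mono) auto
          moreover have "\<phi> t * norm (wave t w) \<le> \<phi> t * 1"
            using wave1[OF w, of t] phi0[of t] by (intro mult_mono) auto
          ultimately have "\<phi> t * norm (wave t w) * (norm (F z) * norm (wave t z)) \<le> (\<phi> t * 1) * (N * 1)"
            using phi0[of t] N0 by (rule_tac mult_mono) auto
          then show ?thesis using phi0[of t] by (simp add: norm_mult)
        qed
      qed (use w in measurable)
      also have "\<dots> = (\<integral>z. cnj (F z) * k z w \<partial>\<nu>)"
        unfolding k_def by (simp flip: integral_mult_right_zero add: mult_ac)
      finally show "(LBINT t. (\<integral>z. of_real (\<phi> t) * cnj (wave t w) * (cnj (F z) * wave t z) \<partial>\<nu>)) = \<dots>" .
    qed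
    finally show ?thesis .
  qed
  have D_le: "D \<le> B * A"
  proof -
    interpret P: pair_sigma_finite \<nu> \<nu> ..
    have D0: "0 \<le> D" unfolding D_def using phi0 by simp
    \<comment> \<open>Schur test with constant weights: AM-GM puts half of \<open>|F|^2\<close>
      against the rows and half against the columns of \<kappa>, and each half contributes at most B
      A / 2.\<close>
    let ?G = "\<lambda>z. ennreal ((norm (F z))\<^sup>2 / 2)"
    have schur1: "(\<integral>\<^sup>+w. ennreal (\<kappa> z w) \<partial>\<nu>) \<le> ennreal B" if "z \<in> space \<nu>" for z
      using schur[OF that] by (simp add: \<kappa>_def)
    have schur2: "(\<integral>\<^sup>+z. ennreal (\<kappa> z w) \<partial>\<nu>) \<le> ennreal B" if "w \<in> space \<nu>" for w
      using schur1[OF that] by (simp add: \<kappa>_def schur_kernel_commute[of m T w])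
    have G: "(\<integral>\<^sup>+z. ?G z \<partial>\<nu>) = ennreal (A / 2)"
      unfolding A_def using F2_int by (subst nn_integral_eq_integral) auto
    have "ennreal D = ennreal (norm (\<integral>w. F w * (\<integral>z. cnj (F z) * k z w \<partial>\<nu>) \<partial>\<nu>))"
      using D0 by (simp flip: D_eq)
    also have "\<dots> \<le> (\<integral>\<^sup>+w. ennreal (norm (F w * (\<integral>z. cnj (F z) * k z w \<partial>\<nu>))) \<partial>\<nu>)"
      by (rule ennreal_norm_integral_le_nn_integral)
    also have "\<dots> \<le> (\<integral>\<^sup>+w. \<integral>\<^sup>+z. ?G w * ennreal (\<kappa> z w) + ?G z * ennreal (\<kappa> z w) \<partial>\<nu> \<partial>\<nu>)"
    proof (intro nn_integral_mono)
      fix w assume w: "w \<in> space \<nu>"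
      have "ennreal (norm (F w * (\<integral>z. cnj (F z) * k z w \<partial>\<nu>)))
          = ennreal (norm (\<integral>z. F w * (cnj (F z) * k z w) \<partial>\<nu>))" by simp
      also have "\<dots> \<le> (\<integral>\<^sup>+z. ennreal (norm (F w * (cnj (F z) * k z w))) \<partial>\<nu>)"
        by (rule ennreal_norm_integral_le_nn_integral)
      also have "\<dots> \<le> (\<integral>\<^sup>+z. ?G w * ennreal (\<kappa> z w) + ?G z * ennreal (\<kappa> z w) \<partial>\<nu>)"
      proof (intro nn_integral_mono)
        fix z assume z: "z \<in> space \<nu>"
        have kp: "0 \<le> \<kappa> z w" using k_le[OF z w] norm_ge_zero order_trans by blast
        have "norm (F w * (cnj (F z) * k z w)) \<le> norm (F w) * norm (F z) * \<kappa> z w"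
          using k_le[OF z w] by (simp add: norm_mult mult_left_mono flip: mult.assoc)
        also have "\<dots> \<le> ((norm (F w))\<^sup>2 / 2 + (norm (F z))\<^sup>2 / 2) * \<kappa> z w"
          using kp sum_squares_bound[of "norm (F w)" "norm (F z)"] by (intro mult_right_mono) auto
        finally show "ennreal (norm (F w * (cnj (F z) * k z w)))
            \<le> ?G w * ennreal (\<kappa> z w) + ?G z * ennreal (\<kappa> z w)"
          using kp by (simp add: distrib_right ennreal_leI flip: ennreal_mult' ennreal_plus)
      qed
      finally show "ennreal (norm (F w * (\<integral>z. cnj (F z) * k z w \<partial>\<nu>)))
          \<le> (\<integral>\<^sup>+z. ?G w * ennreal (\<kappa> z w) + ?G z * ennreal (\<kappa> z w) \<partial>\<nu>)" .
    qed
    also have "\<dots> = (\<integral>\<^sup>+w. \<integral>\<^sup>+z. ?G w * ennreal (\<kappa> z w) \<partial>\<nu> \<partial>\<nu>) + (\<integral>\<^sup>+w. \<integral>\<^sup>+z. ?G z * ennreal (\<kappa> z w) \<partial>\<nu> \<partial>\<nu>)"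
    proof -
      have "(\<integral>\<^sup>+w. \<integral>\<^sup>+z. ?G w * ennreal (\<kappa> z w) + ?G z * ennreal (\<kappa> z w) \<partial>\<nu> \<partial>\<nu>)
          = (\<integral>\<^sup>+w. (\<integral>\<^sup>+z. ?G w * ennreal (\<kappa> z w) \<partial>\<nu>) + (\<integral>\<^sup>+z. ?G z * ennreal (\<kappa> z w) \<partial>\<nu>) \<partial>\<nu>)"
        using \<kappa>_meas1 by (intro nn_integral_cong nn_integral_add) auto
      also have "\<dots> = (\<integral>\<^sup>+w. \<integral>\<^sup>+z. ?G w * ennreal (\<kappa> z w) \<partial>\<nu> \<partial>\<nu>) + (\<integral>\<^sup>+w. \<integral>\<^sup>+z. ?G z * ennreal (\<kappa> z w) \<partial>\<nu> \<partial>\<nu>)"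
        by (intro nn_integral_add) measurable
      finally show ?thesis .
    qed
    also have "(\<integral>\<^sup>+w. \<integral>\<^sup>+z. ?G z * ennreal (\<kappa> z w) \<partial>\<nu> \<partial>\<nu>) = (\<integral>\<^sup>+z. \<integral>\<^sup>+w. ?G z * ennreal (\<kappa> z w) \<partial>\<nu> \<partial>\<nu>)"
      by (rule P.Fubini') measurable
    also have "(\<integral>\<^sup>+z. \<integral>\<^sup>+w. ?G z * ennreal (\<kappa> z w) \<partial>\<nu> \<partial>\<nu>) = (\<integral>\<^sup>+z. ?G z * (\<integral>\<^sup>+w. ennreal (\<kappa> z w) \<partial>\<nu>) \<partial>\<nu>)"
      using \<kappa>_meas1 by (intro nn_integral_cong nn_integral_cmult) auto
    also have "\<dots> \<le> (\<integral>\<^sup>+z. ?G z * ennreal B \<partial>\<nu>)"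
      by (intro nn_integral_mono mult_left_mono schur1) auto
    also have "(\<integral>\<^sup>+w. \<integral>\<^sup>+z. ?G w * ennreal (\<kappa> z w) \<partial>\<nu> \<partial>\<nu>) = (\<integral>\<^sup>+w. ?G w * (\<integral>\<^sup>+z. ennreal (\<kappa> z w) \<partial>\<nu>) \<partial>\<nu>)"
      using \<kappa>_meas1 by (intro nn_integral_cong nn_integral_cmult) auto
    also have "\<dots> \<le> (\<integral>\<^sup>+w. ?G w * ennreal B \<partial>\<nu>)"
      by (intro nn_integral_mono mult_left_mono schur2) auto
    also have "(\<integral>\<^sup>+w. ?G w * ennreal B \<partial>\<nu>) = ennreal (A / 2) * ennreal B"
      by (simp add: nn_integral_multc G)
    finally have "ennreal D \<le> ennreal (A / 2) * ennreal B + ennreal (A / 2) * ennreal B"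
      by (simp add: add_mono)
    also have "\<dots> = ennreal (B * A)"
      using A0 B by (simp flip: ennreal_mult' ennreal_plus add: mult.commute)
    finally show ?thesis using A0 B by (simp add: ennreal_le_iff)
  qed
  have "A = norm (LBINT t. f t * h t)"
    using A0 by (simp flip: A_eq)
  also have "\<dots> \<le> (LBINT t. norm (f t * h t))" by simp
  \<comment> \<open>AM-GM weighted by the Schur bound B, so that D \<le> B A turns the second part
    into A / 2. The majorant may be inserted because it is at least 1 where f is nonzero and
    nonnegative elsewhere.\<close>
  also have "\<dots> \<le> (LBINT t. B / 2 * (norm (f t))\<^sup>2 + 1 / (2 * B) * (\<phi> t * (norm (h t))\<^sup>2))"
  proof (rule integral_mono')
    show "integrable lborel (\<lambda>t. B / 2 * (norm (f t))\<^sup>2 + 1 / (2 * B) * (\<phi> t * (norm (h t))\<^sup>2))"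
      using f2 dual_int by auto
    fix t
    show "norm (f t * h t) \<le> B / 2 * (norm (f t))\<^sup>2 + 1 / (2 * B) * (\<phi> t * (norm (h t))\<^sup>2)"
    proof (cases "f t = 0")
      case True
      then show ?thesis using B phi0[of t] by simp
    next
      case False
      have "1 \<le> \<phi> t" unfolding \<phi>_def using supp[OF False] T by (intro majorant_ge_1) auto
      then have *: "1 * (norm (h t))\<^sup>2 \<le> \<phi> t * (norm (h t))\<^sup>2" by (intro mult_right_mono) auto
      have "0 \<le> (B * norm (f t) - norm (h t))\<^sup>2 / (2 * B)" using B by simp
      also have "\<dots> = B / 2 * (norm (f t))\<^sup>2 + 1 / (2 * B) * (1 * (norm (h t))\<^sup>2) - norm (f t) * norm (h t)"
        using B by (simp add: power2_eq_square field_simps)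
      also have "\<dots> \<le> B / 2 * (norm (f t))\<^sup>2 + 1 / (2 * B) * (\<phi> t * (norm (h t))\<^sup>2) - norm (f t) * norm (h t)"
        using B by (intro diff_right_mono add_left_mono mult_left_mono *) auto
      finally show ?thesis by (simp add: norm_mult)
    qed
    show "0 \<le> B / 2 * (norm (f t))\<^sup>2 + 1 / (2 * B) * (\<phi> t * (norm (h t))\<^sup>2)"
      using B phi0[of t] by simp
  qed
  also have "\<dots> = B / 2 * (LBINT t. (norm (f t))\<^sup>2) + 1 / (2 * B) * D"
    unfolding D_def using f2 dual_int by simp
  also have "\<dots> \<le> B / 2 * (LBINT t. (norm (f t))\<^sup>2) + 1 / (2 * B) * (B * A)"
    using D_le B by (intro add_left_mono mult_left_mono) auto
  finally have "A \<le> B * (LBINT t. (norm (f t))\<^sup>2)"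
    using B by simp
  then show ?thesis using A_nn by (simp add: F_def ennreal_leI)
qed

section \<open>Box geometry, the Schur bound, and removal of finiteness\<close>

lemma sets_upper_half_plane_eq:
  assumes "sets \<mu> = sets (restrict_space borel upper_half_plane)"
  shows "space \<mu> = upper_half_plane" "(\<lambda>z. z) \<in> borel_measurable \<mu>"
proof -
  show "space \<mu> = upper_half_plane" using sets_eq_imp_space_eq[OF assms] by (simp add: space_restrict_space)
  have "(\<lambda>z::complex. z) \<in> borel_measurable (restrict_space borel upper_half_plane)"
    by (rule measurable_restrict_space1) simp
  then show "(\<lambda>z. z) \<in> borel_measurable \<mu>"
    using assms by (simp cong: measurable_cong_sets)
qed

lemma carleson_box_sets:
  assumes "sets \<mu> = sets (restrict_space borel upper_half_plane)" "is_interval I"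
  shows "carleson_box I \<in> sets \<mu>"
proof -
  note [measurable] = sets_upper_half_plane_eq(2)[OF assms(1)] real_interval_borel_measurable[OF assms(2)]
  have "carleson_box I = {z \<in> space \<mu>. Re z \<in> I \<and> 0 < Im z \<and> Im z \<le> measure lborel I}"
    using sets_upper_half_plane_eq(1)[OF assms(1)] by (auto simp: carleson_box_def upper_half_plane_def)
  also have "\<dots> \<in> sets \<mu>" by measurable
  finally show ?thesis .
qed

lemma carleson_box_Icc:
  "a \<le> b \<Longrightarrow> carleson_box {a..b} = {z. a \<le> Re z \<and> Re z \<le> b \<and> 0 < Im z \<and> Im z \<le> b - a}"
  by (auto simp: carleson_box_def)

text \<open>The sum of the geometric series with ratio 2^(s - (m+1)). The factor 2^(m+1) comes from
  the inner radius R/2 of a shell, and 2^s from the box over an interval of length 2R.\<close>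

definition schur_const :: "nat \<Rightarrow> real \<Rightarrow> real" where
  "schur_const m s = 2 ^ Suc m * 2 powr s / (1 - 2 powr (s - Suc m))"

text \<open>
  Around \<open>Re z\<close> the half-plane is exhausted by boxes of size \<open>2\<^sup>j/T\<close>, outside of which the kernel is
  at most \<open>(2\<^sup>j/T)\<^bsup>-(m+1)\<^esup>\<close>.
\<close>

lemma nn_integral_schur_kernel_le:
  fixes \<mu> :: "complex measure" and s :: real
  assumes sets: "sets \<mu> = sets (restrict_space borel upper_half_plane)"
    and C0: "0 \<le> C\<^sub>0"
    and box: "\<And>a b. a < b \<Longrightarrow> emeasure \<mu> (carleson_box {a..b}) \<le> ennreal (C\<^sub>0 * (b - a) powr s)"
    and T: "0 < T" and z: "0 < Im z" and m: "s < Suc m"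
  shows "(\<integral>\<^sup>+w. ennreal (schur_kernel m T z w) \<partial>\<mu>) \<le> ennreal (C\<^sub>0 * schur_const m s * T powr (Suc m - s))"
proof -
  define R where "R j = 2 ^ j / T" for j :: nat
  define Q where "Q j = carleson_box {Re z - R j..Re z + R j}" for j
  have R: "0 < R j" for j using T by (simp add: R_def)
  have Q_sets[measurable]: "Q j \<in> sets \<mu>" for j
    unfolding Q_def by (intro carleson_box_sets sets) auto
  have Q_eq: "Q j = {w. \<bar>Re w - Re z\<bar> \<le> R j \<and> 0 < Im w \<and> Im w \<le> 2 * R j}" for j
    using R[of j] unfolding Q_def by (subst carleson_box_Icc) (auto simp: abs_le_iff)
  have Q_le: "emeasure \<mu> (Q j) \<le> ennreal (C\<^sub>0 * (2 * R j) powr s)" for j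
    using box[of "Re z - R j" "Re z + R j"] R[of j] by (simp add: Q_def)
  \<comment> \<open>The kernel bound on points first caught by Q j: they lie outside the box of half
    the size, hence d \<ge> R j / 2. For j = 0 the term 1/T = R 0 in the real part of d does
    this.\<close>
  define a where "a j = (2 / R j) ^ Suc m" for j
  have a0: "0 \<le> a j" for j using R[of j] unfolding a_def by (intro zero_le_power) auto
  have pt: "ennreal (schur_kernel m T z w) \<le> (\<Sum>j. ennreal (a j) * indicator (Q j) w)"
    if w: "w \<in> space \<mu>" for w
  proof -
    have Imw: "0 < Im w" using w sets_upper_half_plane_eq(1)[OF sets] by (auto simp: upper_half_plane_def)
    define d where "d = norm (1 / of_real T - \<i> * (z - cnj w))"
    have Re_d: "Re (1 / of_real T - \<i> * (z - cnj w)) = 1 / T + (Im z + Im w)" by simp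
    have Im_d: "Im (1 / of_real T - \<i> * (z - cnj w)) = Re w - Re z" by simp
    have d1: "1 / T + (Im z + Im w) \<le> d"
      unfolding d_def Re_d[symmetric] by (rule complex_Re_le_cmod)
    have d2: "\<bar>Re w - Re z\<bar> \<le> d"
      unfolding d_def Im_d[symmetric] by (rule abs_Im_le_cmod)
    have "\<exists>j. w \<in> Q j"
    proof -
      obtain j where "T * (\<bar>Re w - Re z\<bar> + Im w) < 2 ^ j"
        using real_arch_pow[of 2] by auto
      then have "\<bar>Re w - Re z\<bar> + Im w < R j" using T by (simp add: R_def field_simps)
      then show ?thesis using Imw R[of j] by (intro exI[of _ j]) (auto simp: Q_eq)
    qed
    then obtain j where j: "w \<in> Q j" and min: "\<And>i. i < j \<Longrightarrow> w \<notin> Q i"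
      using exists_least_iff[of "\<lambda>j. w \<in> Q j"] by blast
    have "R j / 2 \<le> d"
    proof (cases j)
      case 0
      then have "R j / 2 \<le> 1 / T" using T by (simp add: R_def field_simps)
      then show ?thesis using d1 z Imw by linarith
    next
      case (Suc i)
      then have "R i < \<bar>Re w - Re z\<bar> \<or> 2 * R i < Im w" using min[of i] Imw by (auto simp: Q_eq)
      moreover have "0 < 1 / T" using T by simp
      ultimately have "R i \<le> d" using d1 d2 z R[of i] by linarith
      then show ?thesis by (simp add: Suc R_def)
    qed
    then have "schur_kernel m T z w \<le> 1 / (R j / 2) ^ Suc m"
      unfolding schur_kernel_def d_def[symmetric] using R[of j]
      by (intro divide_left_mono power_mono mult_pos_pos zero_less_power) auto
    also have "\<dots> = a j" by (simp add: a_def power_divide)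
    finally have "ennreal (schur_kernel m T z w) \<le> ennreal (a j) * indicator (Q j) w"
      using j by (simp add: ennreal_leI)
    also have "\<dots> \<le> (\<Sum>j. ennreal (a j) * indicator (Q j) w)"
    proof -
      have "(\<Sum>i\<in>{j}. ennreal (a i) * indicator (Q i) w) \<le> (\<Sum>j. ennreal (a j) * indicator (Q j) w)"
        by (rule sum_le_suminf) auto
      then show ?thesis
        by (simp only: sum.insert sum.empty finite.emptyI empty_iff not_False_eq_True add_0_right)
    qed
    finally show ?thesis .
  qed
  define \<rho> where "\<rho> = (2::real) powr (s - Suc m)"
  have "s - Suc m < 0" using m by simp
  then have rho: "0 < \<rho>" "\<rho> < 1" unfolding \<rho>_def by (auto intro: powr_less_one simp del: of_nat_Suc)
  define K where "K = C\<^sub>0 * (2 ^ Suc m * 2 powr s * T powr (Suc m - s))"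
  have K0: "0 \<le> K" using C0 by (simp add: K_def)
  \<comment> \<open>Box growth R^s against kernel decay R^(-(m+1)): a power of 2^j with negative
    exponent, since s < m + 1.\<close>
  have term_eq: "a j * (C\<^sub>0 * (2 * R j) powr s) = K * \<rho> ^ j" for j
  proof -
    have "R j powr s / R j ^ Suc m = R j powr (s - Suc m)"
      using R[of j] by (simp add: powr_diff powr_realpow del: power_Suc of_nat_Suc)
    also have "\<dots> = (2 ^ j) powr (s - Suc m) / T powr (s - Suc m)"
      using T by (simp add: R_def powr_divide)
    also have "(2 ^ j) powr (s - Suc m) = \<rho> ^ j"
      by (simp add: \<rho>_def powr_realpow[symmetric] powr_powr mult.commute)
    also have "\<rho> ^ j / T powr (s - Suc m) = T powr (Suc m - s) * \<rho> ^ j"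
      using T powr_minus_divide[of T "s - Suc m"] by (simp add: field_simps)
    finally have "R j powr s / R j ^ Suc m = T powr (Suc m - s) * \<rho> ^ j" .
    moreover have "a j * (C\<^sub>0 * (2 * R j) powr s) = C\<^sub>0 * (2 ^ Suc m * 2 powr s * (R j powr s / R j ^ Suc m))"
      by (simp add: a_def powr_mult power_divide del: power_Suc)
    ultimately show ?thesis by (simp add: K_def del: power_Suc)
  qed
  have "(\<integral>\<^sup>+w. ennreal (schur_kernel m T z w) \<partial>\<mu>) \<le> (\<integral>\<^sup>+w. (\<Sum>j. ennreal (a j) * indicator (Q j) w) \<partial>\<mu>)"
    by (intro nn_integral_mono pt)
  also have "\<dots> = (\<Sum>j. ennreal (a j) * emeasure \<mu> (Q j))"
    by (subst nn_integral_suminf) (auto simp: nn_integral_cmult_indicator)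
  also have "\<dots> \<le> (\<Sum>j. ennreal (a j) * ennreal (C\<^sub>0 * (2 * R j) powr s))"
    by (intro suminf_le mult_left_mono Q_le) auto
  also have "\<dots> = (\<Sum>j. ennreal (K * \<rho> ^ j))"
    using a0 by (simp flip: ennreal_mult' add: term_eq)
  also have "\<dots> = ennreal (\<Sum>j. K * \<rho> ^ j)"
    using K0 rho by (intro suminf_ennreal_eq[symmetric] suminf_ennreal2) auto
  also have "(\<Sum>j. K * \<rho> ^ j) = K * (1 / (1 - \<rho>))"
    using rho by (simp add: suminf_mult suminf_geometric)
  also have "\<dots> = C\<^sub>0 * schur_const m s * T powr (Suc m - s)"
    by (simp add: K_def schur_const_def \<rho>_def field_simps)
  finally show ?thesis .
qed

text \<open>Every box has finite measure, so the finite case applies to \<open>\<mu>\<close> cut off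
  to a growing sequence of boxes. Cutting off only lowers the Schur integral, so B is the same for
  all of them, and monotone convergence concludes. For s = 1 the power of T disappears, in
  accordance with Carleson's embedding theorem for the Hardy space \<open>H^2\<close>.\<close>

lemma nn_integral_wave_transform_square_le:
  fixes \<mu> :: "complex measure" and f :: "real \<Rightarrow> complex" and s :: real
  assumes sets: "sets \<mu> = sets (restrict_space borel upper_half_plane)"
    and C0: "0 < C\<^sub>0"
    and box: "\<And>a b. a < b \<Longrightarrow> emeasure \<mu> (carleson_box {a..b}) \<le> ennreal (C\<^sub>0 * (b - a) powr s)"
    and m: "s < Suc m"
    and f1: "integrable lborel f"
    and f2: "integrable lborel (\<lambda>t. (norm (f t))\<^sup>2)"
    and supp: "\<And>t. f t \<noteq> 0 \<Longrightarrow> T \<le> t \<and> t \<le> 2 * T"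
    and T: "0 < T"
  shows "(\<integral>\<^sup>+z. ennreal ((norm (LBINT t. f t * wave t z))\<^sup>2) \<partial>\<mu>)
    \<le> ennreal (exp (4 * pi) * fact m * C\<^sub>0 * schur_const m s * T powr (1 - s) * (LBINT t. (norm (f t))\<^sup>2))"
proof -
  note space = sets_upper_half_plane_eq(1)[OF sets] and id = sets_upper_half_plane_eq(2)[OF sets]
  note [measurable] = measurable_wave[OF id] measurable_schur_kernel[OF id]
  define B where "B = exp (4 * pi) * fact m * C\<^sub>0 * schur_const m s * T powr (1 - s)"
  have "0 < schur_const m s"
    using m powr_less_one[of 2 "s - Suc m"] unfolding schur_const_def
    by (intro divide_pos_pos mult_pos_pos) auto
  then have B: "0 < B" using C0 T by (simp add: B_def)
  define G where "G z = ennreal ((norm (LBINT t. f t * wave t z))\<^sup>2)" for z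
  have f_meas[measurable]: "f \<in> borel_measurable borel" using f1 by auto
  have G_meas[measurable]: "G \<in> borel_measurable \<mu>"
    unfolding G_def by measurable
  \<comment> \<open>\<open>Suc n\<close> keeps the interval nondegenerate at n = 0, as
    \<open>box\<close> demands.\<close>
  define Q where "Q n = carleson_box {- real (Suc n)..real (Suc n)}" for n
  have Q_sets[measurable]: "Q n \<in> sets \<mu>" for n
    unfolding Q_def by (intro carleson_box_sets sets) auto
  have Q_eq: "Q n = {w. \<bar>Re w\<bar> \<le> Suc n \<and> 0 < Im w \<and> Im w \<le> 2 * Suc n}" for n
    unfolding Q_def by (subst carleson_box_Icc) (auto simp: abs_le_iff)
  have bound: "(\<integral>\<^sup>+z. G z * indicator (Q n) z \<partial>\<mu>) \<le> ennreal (B * (LBINT t. (norm (f t))\<^sup>2))" for n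
  proof -
    define \<nu> where "\<nu> = density \<mu> (indicator (Q n))"
    have "(\<integral>\<^sup>+z. ennreal ((norm (LBINT t. f t * wave t z))\<^sup>2) \<partial>\<nu>)
      \<le> ennreal (B * (LBINT t. (norm (f t))\<^sup>2))"
    proof (rule nn_integral_wave_transform_finite[OF _ _ _ f1 f2 supp T B])
      show "finite_measure \<nu>"
      proof
        have "emeasure \<nu> (space \<nu>) = emeasure \<mu> (Q n)"
          unfolding \<nu>_def by (simp add: emeasure_density cong: nn_integral_cong)
        also have "\<dots> < top"
          using box[of "- real (Suc n)" "real (Suc n)"] unfolding Q_def
          by (rule le_less_trans) auto
        finally show "emeasure \<nu> (space \<nu>) \<noteq> \<infinity>" by simp
      qed
      show "(\<lambda>z. z) \<in> borel_measurable \<nu>" using id by (simp add: \<nu>_def)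
      show "0 < Im z" if "z \<in> space \<nu>" for z
        using that by (simp add: \<nu>_def space upper_half_plane_def)
      show "(\<integral>\<^sup>+w. ennreal (exp (4 * pi) * fact m / T ^ m * schur_kernel m T z w) \<partial>\<nu>) \<le> ennreal B"
        if z: "z \<in> space \<nu>" for z
      proof -
        have z': "z \<in> space \<mu>" using z by (simp add: \<nu>_def)
        then have Imz: "0 < Im z" by (simp add: space upper_half_plane_def)
        have [measurable]: "schur_kernel m T z \<in> borel_measurable \<mu>"
          using z' by (intro measurable_schur_kernel[OF id]) auto
        have "(\<integral>\<^sup>+w. ennreal (exp (4 * pi) * fact m / T ^ m * schur_kernel m T z w) \<partial>\<nu>)
          \<le> (\<integral>\<^sup>+w. ennreal (exp (4 * pi) * fact m / T ^ m * schur_kernel m T z w) \<partial>\<mu>)"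
          unfolding \<nu>_def by (subst nn_integral_density) (auto intro!: nn_integral_mono simp: indicator_def)
        also have "\<dots> = ennreal (exp (4 * pi) * fact m / T ^ m) * (\<integral>\<^sup>+w. ennreal (schur_kernel m T z w) \<partial>\<mu>)"
          using T by (subst ennreal_mult') (auto intro!: nn_integral_cmult)
        also have "\<dots> \<le> ennreal (exp (4 * pi) * fact m / T ^ m) * ennreal (C\<^sub>0 * schur_const m s * T powr (Suc m - s))"
          using nn_integral_schur_kernel_le[OF sets less_imp_le[OF C0] box T Imz m]
          by (intro mult_left_mono) auto
        also have "\<dots> = ennreal (exp (4 * pi) * fact m / T ^ m * (C\<^sub>0 * schur_const m s * T powr (Suc m - s)))"
          using T by (simp flip: ennreal_mult')
        also have "T powr (Suc m - s) = T ^ m * T powr (1 - s)"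
          using T by (simp flip: powr_realpow powr_add) (simp add: algebra_simps)
        finally show ?thesis using T by (simp add: B_def mult_ac)
      qed
    qed
    then show ?thesis unfolding \<nu>_def G_def[symmetric]
      by (subst (asm) nn_integral_density) (auto simp: mult.commute)
  qed
  have inc: "Q n \<subseteq> Q (Suc n)" for n by (auto simp: Q_eq)
  have "(\<integral>\<^sup>+z. G z \<partial>\<mu>) = (\<integral>\<^sup>+z. (SUP n. G z * indicator (Q n) z) \<partial>\<mu>)"
  proof (intro nn_integral_cong antisym)
    fix z assume "z \<in> space \<mu>"
    then have z: "0 < Im z" by (simp add: space upper_half_plane_def)
    obtain n where "\<bar>Re z\<bar> + Im z \<le> real n" using real_arch_simple by blast
    then have "z \<in> Q n" using z by (auto simp: Q_eq)
    then have "G z = G z * indicator (Q n) z" by simp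
    also have "\<dots> \<le> (SUP n. G z * indicator (Q n) z)" by (rule SUP_upper) simp
    finally show "G z \<le> (SUP n. G z * indicator (Q n) z)" .
  qed (auto intro!: SUP_least simp: indicator_def)
  also have "\<dots> = (SUP n. \<integral>\<^sup>+z. G z * indicator (Q n) z \<partial>\<mu>)"
    using inc by (intro nn_integral_monotone_convergence_SUP)
      (auto intro!: incseq_SucI le_funI mult_left_mono simp: indicator_def dest: subsetD[OF inc])
  also have "\<dots> \<le> ennreal (B * (LBINT t. (norm (f t))\<^sup>2))"
    by (intro SUP_least bound)
  finally show ?thesis by (simp add: G_def B_def)
qed

text \<open>
  Splitting at the height \<open>\<lambda>\<close> with \<open>a = \<lambda>\<^sup>p T\<^bsup>\<alpha>+1\<^esup>\<close> replaces Hoelder's inequality.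
\<close>

lemma nn_integral_block_powr_le:
  fixes G :: "real \<Rightarrow> complex"
  assumes [measurable]: "G \<in> borel_measurable borel"
    and supp: "\<And>t. G t \<noteq> 0 \<Longrightarrow> T \<le> t \<and> t \<le> 2 * T"
    and T: "0 < T" and a: "0 < a" and r: "0 < r" "r \<le> p"
    and le: "(\<integral>\<^sup>+t. ennreal (t powr \<alpha> * norm (G t) powr p) \<partial>lborel) \<le> ennreal a"
  shows "(\<integral>\<^sup>+t. ennreal (norm (G t) powr r) \<partial>lborel)
    \<le> ennreal ((1 + 2 powr \<bar>\<alpha>\<bar>) * (T * (a * T powr (-\<alpha> - 1)) powr (r / p)))"
proof -
  define l where "l = (a * T powr (-\<alpha> - 1)) powr (1 / p)"
  have l: "0 < l" using a T by (simp add: l_def)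
  have lr: "l powr r = (a * T powr (-\<alpha> - 1)) powr (r / p)"
    by (simp add: l_def powr_powr)
  have lp: "l powr p = a * T powr (-\<alpha> - 1)"
    using a T r by (simp add: l_def powr_powr)
  \<comment> \<open>On [T, 2T] the weight t^\<alpha> differs from T^\<alpha> by a factor of at most
    2^|\<alpha>|; above the height l, |G|^r is at most l^(r-p) |G|^p because r \<le> p.\<close>
  define K where "K = l powr (r - p) * 2 powr \<bar>\<alpha>\<bar> * T powr (-\<alpha>)"
  have pt: "norm (G t) powr r \<le> l powr r * indicator {T..2 * T} t + K * (t powr \<alpha> * norm (G t) powr p)" for t
  proof (cases "G t = 0")
    case True
    then show ?thesis using l by simp
  next
    case False
    have t: "T \<le> t" "t \<le> 2 * T" using supp[OF False] by auto
    have "1 \<le> 2 powr \<bar>\<alpha>\<bar> * T powr (-\<alpha>) * t powr \<alpha>"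
    proof -
      have "(t / T) powr (-\<alpha>) \<le> (t / T) powr \<bar>\<alpha>\<bar>" using t T by (intro powr_mono) auto
      also have "\<dots> \<le> 2 powr \<bar>\<alpha>\<bar>" using t T by (intro powr_mono2) (auto simp: field_simps)
      finally have "(t / T) powr (-\<alpha>) * (t / T) powr \<alpha> \<le> 2 powr \<bar>\<alpha>\<bar> * (t / T) powr \<alpha>"
        by (intro mult_right_mono) auto
      moreover have "(t / T) powr (-\<alpha>) * (t / T) powr \<alpha> = 1" using t T by (simp flip: powr_add)
      ultimately show ?thesis using T t by (simp add: powr_divide powr_minus field_simps)
    qed
    then have *: "l powr (r - p) * norm (G t) powr p * 1 \<le> l powr (r - p) * norm (G t) powr p * (2 powr \<bar>\<alpha>\<bar> * T powr (-\<alpha>) * t powr \<alpha>)"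
      by (intro mult_left_mono) auto
    have "norm (G t) powr r \<le> l powr r + l powr (r - p) * norm (G t) powr p"
    proof (cases "norm (G t) \<le> l")
      case True
      then have "norm (G t) powr r \<le> l powr r" using r by (intro powr_mono2) auto
      then show ?thesis by (simp add: add_increasing2)
    next
      case False
      have "norm (G t) powr (r - p) \<le> l powr (r - p)"
        using False l r by (intro powr_mono2') auto
      then have "norm (G t) powr (r - p) * norm (G t) powr p \<le> l powr (r - p) * norm (G t) powr p"
        by (intro mult_right_mono) auto
      then have "norm (G t) powr r \<le> l powr (r - p) * norm (G t) powr p"
        by (simp flip: powr_add)
      then show ?thesis by (simp add: add_increasing)
    qed
    then show ?thesis using * t by (simp add: K_def mult_ac)
  qed
  have K0: "0 \<le> K" by (simp add: K_def)
  have "(\<integral>\<^sup>+t. ennreal (norm (G t) powr r) \<partial>lborel)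
      \<le> (\<integral>\<^sup>+t. ennreal (l powr r) * indicator {T..2 * T} t + ennreal K * ennreal (t powr \<alpha> * norm (G t) powr p) \<partial>lborel)"
  proof (intro nn_integral_mono)
    fix t
    have "ennreal (norm (G t) powr r) \<le> ennreal (l powr r * indicator {T..2 * T} t + K * (t powr \<alpha> * norm (G t) powr p))"
      by (intro ennreal_leI pt)
    also have "\<dots> = ennreal (l powr r) * indicator {T..2 * T} t + ennreal K * ennreal (t powr \<alpha> * norm (G t) powr p)"
      using K0 by (simp add: ennreal_mult' indicator_def)
    finally show "ennreal (norm (G t) powr r) \<le> \<dots>" .
  qed
  also have "\<dots> = ennreal (l powr r) * ennreal T + ennreal K * (\<integral>\<^sup>+t. ennreal (t powr \<alpha> * norm (G t) powr p) \<partial>lborel)"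
    using T by (simp add: nn_integral_add nn_integral_cmult nn_integral_cmult_indicator)
  also have "\<dots> \<le> ennreal (l powr r) * ennreal T + ennreal K * ennreal a"
    using le by (intro add_left_mono mult_left_mono) auto
  also have "\<dots> = ennreal (l powr r * T + K * a)"
    using T a K0 by (simp flip: ennreal_mult' ennreal_plus)
  \<comment> \<open>The choice of l makes the part above the height match the part below, T l^r, up
    to the factor 2^|\<alpha>|.\<close>
  also have "K * a = 2 powr \<bar>\<alpha>\<bar> * (T * l powr r)"
  proof -
    have "a = l powr p * T powr (\<alpha> + 1)"
      using T by (simp add: lp mult.assoc flip: powr_add)
    then have "K * a = 2 powr \<bar>\<alpha>\<bar> * ((l powr (r - p) * l powr p) * (T powr (-\<alpha>) * T powr (\<alpha> + 1)))"
      by (simp add: K_def mult_ac)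
    also have "\<dots> = 2 powr \<bar>\<alpha>\<bar> * (l powr r * T powr 1)" by (simp flip: powr_add)
    finally show ?thesis using T by (simp add: mult.commute)
  qed
  finally show ?thesis by (simp add: lr algebra_simps)
qed

section \<open>Sufficiency of the Carleson condition\<close>

lemma sum_indicator_Ico_mono:
  fixes T :: "nat \<Rightarrow> real"
  assumes "mono T"
  shows "(\<Sum>i<n. indicator {T i..<T (Suc i)} t) = (indicator {T 0..<T n} t :: 'a::semiring_1)"
proof (induction n)
  case (Suc n)
  have "T 0 \<le> T n" "T n \<le> T (Suc n)" using assms by (auto simp: mono_def)
  then show ?case using Suc by (auto simp: indicator_def)
qed simp

text \<open>The inclusion of \<open>l^1\<close> in \<open>l^r\<close>: one factor is kept and the
  remaining r - 1 are bounded by the total. It is used with r = q / p, where p \<le> q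
  enters.\<close>

lemma sum_powr_le_powr_sum:
  fixes a :: "nat \<Rightarrow> real"
  assumes "\<And>i. 0 \<le> a i" "1 \<le> r"
  shows "(\<Sum>i<n. a i powr r) \<le> (\<Sum>i<n. a i) powr r"
proof -
  let ?S = "\<Sum>i<n. a i"
  have split: "x powr r = x * x powr (r - 1)" if "0 \<le> x" for x :: real
    using that assms(2) by (cases "x = 0") (auto simp: powr_diff)
  have "(\<Sum>i<n. a i powr r) \<le> (\<Sum>i<n. a i * ?S powr (r - 1))"
  proof (intro sum_mono)
    fix i assume "i \<in> {..<n}"
    then have "a i \<le> ?S" using assms by (intro member_le_sum) auto
    then show "a i powr r \<le> a i * ?S powr (r - 1)"
      unfolding split[OF assms(1)] using assms by (intro mult_left_mono powr_mono2) auto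
  qed
  also have "\<dots> = ?S powr r"
    using assms by (simp add: split sum_nonneg flip: sum_distrib_right)
  finally show ?thesis .
qed

text \<open>The constant K must be independent of the starting scale T0 and of the number n of
  blocks, since both are later sent to their limits.\<close>

lemma nn_integral_wave_transform_dyadic_le:
  fixes p q \<alpha> s C\<^sub>0 :: real and \<mu> :: "complex measure"
  assumes p: "2 < p" and pq: "p \<le> q"
    and s_def: "s = q * (1 - (1 + \<alpha>) / p)" and s: "0 < s"
    and sets: "sets \<mu> = sets (restrict_space borel upper_half_plane)"
    and C0: "0 < C\<^sub>0"
    and box: "\<And>a b. a < b \<Longrightarrow> emeasure \<mu> (carleson_box {a..b}) \<le> ennreal (C\<^sub>0 * (b - a) powr s)"
  shows "\<exists>K. 0 \<le> K \<and> (\<forall>F j T0 n. F \<in> borel_measurable borel \<longrightarrow> 0 < j \<longrightarrow> 0 < T0 \<longrightarrow>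
     (\<integral>\<^sup>+t. ennreal (t powr \<alpha> * norm (F t :: complex) powr p) \<partial>lborel) \<le> ennreal j \<longrightarrow>
     (\<integral>\<^sup>+z. ennreal (norm (LBINT t. (indicator {T0..<T0 * 2 ^ n} t *\<^sub>R F t) * wave t z) powr q) \<partial>\<mu>)
       \<le> ennreal (K * j powr (q / p)))"
proof -
  \<comment> \<open>Any m with m + 1 > s would serve; it fixes the decay of the Schur
    kernel.\<close>
  define m where "m = nat \<lceil>s\<rceil>"
  have m: "s < Suc m" unfolding m_def by linarith
  define B where "B = exp (4 * pi) * fact m * C\<^sub>0 * schur_const m s"
  have "0 \<le> schur_const m s"
    using m powr_less_one[of 2 "s - Suc m"] unfolding schur_const_def
    by (intro divide_nonneg_nonneg mult_nonneg_nonneg) auto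
  then have B: "0 \<le> B" using C0 by (simp add: B_def)
  define c where "c = 1 + 2 powr \<bar>\<alpha>\<bar>"
  have c: "0 \<le> c" by (simp add: c_def add_nonneg_nonneg)
  have q: "2 < q" using p pq by simp
  define K where "K = q * (q - 1) * c powr (q - 2) * (B * c) * interp_const q s"
  have "0 < interp_const q s"
  proof -
    have "s * 2 < s * q" using q s by (intro mult_strict_left_mono) auto
    then have "s / q - s / 2 < 0" using q by (simp add: field_simps)
    then show ?thesis unfolding interp_const_def using powr_less_one[of 2 "s / q - s / 2"]
      by (intro divide_pos_pos add_pos_nonneg) auto
  qed
  then have K: "0 \<le> K" using q B c unfolding K_def by (intro mult_nonneg_nonneg) auto
  have sq: "s / q = 1 - (1 + \<alpha>) / p" using q by (simp add: s_def)
  have main: "(\<integral>\<^sup>+z. ennreal (norm (LBINT t. (indicator {T0..<T0 * 2 ^ n} t *\<^sub>R F t) * wave t z) powr q) \<partial>\<mu>)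
       \<le> ennreal (K * 2 powr (q / p) * j powr (q / p))"
    if F[measurable]: "F \<in> borel_measurable borel" and j: "0 < j" and T0: "0 < T0"
      and J: "(\<integral>\<^sup>+t. ennreal (t powr \<alpha> * norm (F t :: complex) powr p) \<partial>lborel) \<le> ennreal j"
    for F j T0 n
  proof -
    note id = sets_upper_half_plane_eq(2)[OF sets] and space = sets_upper_half_plane_eq(1)[OF sets]
    note [measurable] = measurable_wave[OF id]
    define T where "T i = T0 * 2 ^ i" for i
    have T: "0 < T i" for i using T0 by (simp add: T_def)
    have T_mono: "mono T" using T0 by (auto simp: T_def mono_def)
    have T_Suc: "T (Suc i) = 2 * T i" for i by (simp add: T_def)
    define I where "I i = {T i..<T (Suc i)}" for i
    have [measurable]: "I i \<in> sets borel" for i by (simp add: I_def)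
    define f where "f i t = indicator (I i) t *\<^sub>R F t" for i t
    have f_meas[measurable]: "f i \<in> borel_measurable borel" for i by (simp add: f_def[abs_def])
    define W where "W t = ennreal (t powr \<alpha> * norm (F t) powr p)" for t
    have [measurable]: "W \<in> borel_measurable borel" by (simp add: W_def[abs_def])
    define b where "b i = (\<integral>\<^sup>+t. W t * indicator (I i) t \<partial>lborel)" for i
    have b_sum: "(\<Sum>i<n. b i) \<le> ennreal j" for n
    proof -
      have "(\<Sum>i<n. b i) = (\<integral>\<^sup>+t. W t * (\<Sum>i<n. indicator (I i) t) \<partial>lborel)"
        unfolding b_def sum_distrib_left by (subst nn_integral_sum) auto
      also have "\<dots> \<le> (\<integral>\<^sup>+t. W t \<partial>lborel)"
        unfolding I_def sum_indicator_Ico_mono[OF T_mono] by (intro nn_integral_mono) (auto simp: indicator_def)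
      finally show ?thesis using J by (simp add: W_def)
    qed
    have b_fin: "b i < top" for i
    proof -
      have "b i \<le> (\<Sum>i<Suc i. b i)" by (intro member_le_sum) auto
      also have "\<dots> \<le> ennreal j" by (rule b_sum)
      finally show ?thesis by (rule le_less_trans) simp
    qed
    \<comment> \<open>The added share makes every a i positive, as the interpolation lemma requires
      even of empty blocks. Over n blocks it adds at most j, whence the total 2 j and the factor
      2^(q/p) in the constant.\<close>
    define a where "a i = enn2real (b i) + j / Suc n" for i
    have a: "0 < a i" for i using j by (simp add: a_def add_nonneg_pos)
    have "(\<Sum>i<n. enn2real (b i)) \<le> j"
    proof -
      have "ennreal (\<Sum>i<n. enn2real (b i)) = (\<Sum>i<n. b i)"
        using b_fin by (simp flip: sum_ennreal)
      then have "ennreal (\<Sum>i<n. enn2real (b i)) \<le> ennreal j" using b_sum[of n] by simp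
      then show ?thesis using j by (subst (asm) ennreal_le_iff) auto
    qed
    moreover have "(\<Sum>i<n. j / Suc n) \<le> j" using j by (simp add: field_simps)
    ultimately have a_sum: "(\<Sum>i<n. a i) \<le> 2 * j" by (simp add: a_def sum.distrib del: sum_constant)
    define A where "A i = a i powr (1 / p)" for i
    have A: "0 < A i" for i using a[of i] by (simp add: A_def)
    define M where "M i = T i powr (s / q) * A i" for i
    have M: "0 < M i" for i using T[of i] A[of i] by (simp add: M_def)
    \<comment> \<open>The \<open>L^1\<close> bound of the block is M i because 1 - (1 + \<alpha>)/p
      = s/q. The case r = 2 gives (M i)^2 / T i in the same way.\<close>
    have lam: "T i * (a i * T i powr (- \<alpha> - 1)) powr (1 / p) = M i" for i
    proof -
      have "(a i * T i powr (- \<alpha> - 1)) powr (1 / p) = A i * T i powr ((- \<alpha> - 1) * (1 / p))"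
        by (simp add: powr_mult powr_powr A_def)
      also have "T i * (A i * T i powr ((- \<alpha> - 1) * (1 / p))) = A i * (T i powr 1 * T i powr ((- \<alpha> - 1) * (1 / p)))"
        using T[of i] by simp
      also have "T i powr 1 * T i powr ((- \<alpha> - 1) * (1 / p)) = T i powr (s / q)"
        unfolding powr_add[symmetric] sq using p by (simp add: field_simps)
      finally show ?thesis by (simp add: M_def)
    qed
    have lam2: "T i * (a i * T i powr (- \<alpha> - 1)) powr (2 / p) = (M i)\<^sup>2 / T i" for i
    proof -
      have "(a i * T i powr (- \<alpha> - 1)) powr (2 / p) = ((a i * T i powr (- \<alpha> - 1)) powr (1 / p))\<^sup>2"
        by (simp add: power2_eq_square flip: powr_add)
      then show ?thesis using T[of i] by (simp add: power2_eq_square field_simps flip: lam)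
    qed
    have supp: "T i \<le> t \<and> t \<le> 2 * T i" if "f i t \<noteq> 0" for i t
      using that by (auto simp: f_def I_def T_Suc indicator_def split: if_splits)
    have f_le: "(\<integral>\<^sup>+t. ennreal (norm (f i t) powr r) \<partial>lborel)
      \<le> ennreal (c * (T i * (a i * T i powr (- \<alpha> - 1)) powr (r / p)))" if "0 < r" "r \<le> p" for i r
      unfolding c_def
    proof (rule nn_integral_block_powr_le[OF f_meas supp T a that])
      have "(\<integral>\<^sup>+t. ennreal (t powr \<alpha> * norm (f i t) powr p) \<partial>lborel) = b i"
        unfolding b_def W_def f_def by (intro nn_integral_cong) (auto simp: indicator_def)
      also have "\<dots> = ennreal (enn2real (b i))" using b_fin by simp
      also have "\<dots> \<le> ennreal (a i)" using j by (intro ennreal_leI) (simp add: a_def)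
      finally show "(\<integral>\<^sup>+t. ennreal (t powr \<alpha> * norm (f i t) powr p) \<partial>lborel) \<le> ennreal (a i)" .
    qed
    have f1_le: "(\<integral>\<^sup>+t. ennreal (norm (f i t)) \<partial>lborel) \<le> ennreal (c * M i)" for i
      using f_le[of 1 i] p by (simp add: lam)
    have f1: "integrable lborel (f i)" for i
      using f1_le[of i] by (intro integrableI_bounded) (auto intro: le_less_trans)
    have f2_le: "(\<integral>\<^sup>+t. ennreal ((norm (f i t))\<^sup>2) \<partial>lborel) \<le> ennreal (c * ((M i)\<^sup>2 / T i))" for i
      using f_le[of 2 i] p by (simp add: lam2)
    have f2: "integrable lborel (\<lambda>t. (norm (f i t))\<^sup>2)" for i
      using f2_le[of i] by (intro integrableI_bounded) (auto intro: le_less_trans)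
    define g where "g i z = (if z \<in> space \<mu> then norm (LBINT t. f i t * wave t z) else 0)" for i z
    have g_meas[measurable]: "g i \<in> borel_measurable \<mu>" for i
      unfolding g_def[abs_def] by measurable
    have wave1: "norm (wave t z) \<le> 1" if "z \<in> space \<mu>" for t z
      using that by (intro norm_wave_le_1) (auto simp: space upper_half_plane_def)
    have fw: "integrable lborel (\<lambda>t. f i t * wave t z)" if "z \<in> space \<mu>" for i z
    proof (rule Bochner_Integration.integrable_bound[OF f1])
      show "(\<lambda>t. f i t * wave t z) \<in> borel_measurable lborel"
        using that by measurable
      show "AE t in lborel. norm (f i t * wave t z) \<le> norm (f i t)"
        using wave1[OF that] by (intro AE_I2) (auto simp: norm_mult mult_left_le)
    qed
    have L: "(\<integral>\<^sup>+z. ennreal ((\<Sum>i<n. g i z) powr q) \<partial>\<mu>)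
      \<le> ennreal (q * (q - 1) * c powr (q - 2) * (B * c) * interp_const q s * (\<Sum>i<n. A i powr q))"
    proof (rule nn_integral_dyadic_sum_powr_le[OF q s T0 A c _ g_meas])
      show "0 \<le> B * c" using B c by simp
      show "0 \<le> g i z" for i z by (simp add: g_def)
      show "g i z \<le> c * ((T0 * 2 ^ i) powr (s / q) * A i)" if z: "z \<in> space \<mu>" for i z
      proof -
        have "ennreal (g i z) \<le> (\<integral>\<^sup>+t. ennreal (norm (f i t * wave t z)) \<partial>lborel)"
          using z by (simp add: g_def ennreal_norm_integral_le_nn_integral)
        also have "\<dots> \<le> (\<integral>\<^sup>+t. ennreal (norm (f i t)) \<partial>lborel)"
          using wave1[OF z] by (intro nn_integral_mono ennreal_leI) (auto simp: norm_mult mult_left_le)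
        also note f1_le
        finally show ?thesis using c M[of i] by (simp add: ennreal_le_iff M_def T_def)
      qed
      show "(\<integral>\<^sup>+z. ennreal ((g i z)\<^sup>2) \<partial>\<mu>)
        \<le> ennreal (B * c * ((T0 * 2 ^ i) powr (- s) * ((T0 * 2 ^ i) powr (s / q) * A i)\<^sup>2))" for i
      proof -
        have "(\<integral>\<^sup>+z. ennreal ((g i z)\<^sup>2) \<partial>\<mu>) = (\<integral>\<^sup>+z. ennreal ((norm (LBINT t. f i t * wave t z))\<^sup>2) \<partial>\<mu>)"
          by (intro nn_integral_cong) (simp add: g_def)
        also have "\<dots> \<le> ennreal (B * T i powr (1 - s) * (LBINT t. (norm (f i t))\<^sup>2))"
          unfolding B_def by (rule nn_integral_wave_transform_square_le[OF sets C0 box m f1 f2 supp T])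
        also have "\<dots> \<le> ennreal (B * T i powr (1 - s) * (c * ((M i)\<^sup>2 / T i)))"
        proof -
          have "ennreal (LBINT t. (norm (f i t))\<^sup>2) \<le> ennreal (c * ((M i)\<^sup>2 / T i))"
            using f2_le[of i] f2[of i] by (subst (asm) nn_integral_eq_integral) auto
          then have "(LBINT t. (norm (f i t))\<^sup>2) \<le> c * ((M i)\<^sup>2 / T i)"
            using c T[of i] by (subst (asm) ennreal_le_iff) auto
          then show ?thesis using B by (intro ennreal_leI mult_left_mono) auto
        qed
        also have "B * T i powr (1 - s) * (c * ((M i)\<^sup>2 / T i)) = B * c * (T i powr (- s) * (M i)\<^sup>2)"
          using T[of i] by (simp add: powr_diff powr_minus field_simps)
        finally show ?thesis by (simp add: M_def T_def)
      qed
    qed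
    have "(\<integral>\<^sup>+z. ennreal (norm (LBINT t. (indicator {T0..<T0 * 2 ^ n} t *\<^sub>R F t) * wave t z) powr q) \<partial>\<mu>)
      \<le> (\<integral>\<^sup>+z. ennreal ((\<Sum>i<n. g i z) powr q) \<partial>\<mu>)"
    proof (intro nn_integral_mono ennreal_leI powr_mono2)
      fix z assume z: "z \<in> space \<mu>"
      have "(LBINT t. (indicator {T0..<T0 * 2 ^ n} t *\<^sub>R F t) * wave t z) = (LBINT t. (\<Sum>i<n. f i t * wave t z))"
      proof (intro Bochner_Integration.integral_cong refl)
        fix t
        have "indicator {T0..<T0 * 2 ^ n} t = (\<Sum>i<n. indicator (I i) t :: real)"
          unfolding I_def sum_indicator_Ico_mono[OF T_mono] by (simp add: T_def)
        then show "(indicator {T0..<T0 * 2 ^ n} t *\<^sub>R F t) * wave t z = (\<Sum>i<n. f i t * wave t z)"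
          by (simp add: f_def scaleR_sum_left sum_distrib_right)
      qed
      also have "\<dots> = (\<Sum>i<n. (LBINT t. f i t * wave t z))"
        using fw[OF z] by (intro Bochner_Integration.integral_sum) auto
      finally show "norm (LBINT t. (indicator {T0..<T0 * 2 ^ n} t *\<^sub>R F t) * wave t z) \<le> (\<Sum>i<n. g i z)"
        using z by (simp add: g_def norm_sum)
    qed (use q in auto)
    also note L
    also have "q * (q - 1) * c powr (q - 2) * (B * c) * interp_const q s * (\<Sum>i<n. A i powr q)
      \<le> K * 2 powr (q / p) * j powr (q / p)"
    proof -
      have "(\<Sum>i<n. A i powr q) = (\<Sum>i<n. a i powr (q / p))"
        by (simp add: A_def powr_powr)
      also have "\<dots> \<le> (\<Sum>i<n. a i) powr (q / p)"
        using less_imp_le[OF a] p pq by (intro sum_powr_le_powr_sum) auto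
      also have "\<dots> \<le> (2 * j) powr (q / p)"
        using a_sum less_imp_le[OF a] p pq by (intro powr_mono2 sum_nonneg) auto
      also have "\<dots> = 2 powr (q / p) * j powr (q / p)" by (simp add: powr_mult)
      finally have "K * (\<Sum>i<n. A i powr q) \<le> K * (2 powr (q / p) * j powr (q / p))"
        using K by (intro mult_left_mono) auto
      then show ?thesis by (simp add: K_def mult.assoc)
    qed
    finally show ?thesis by (simp add: ennreal_leI)
  qed
  show ?thesis
    by (intro exI[of _ "K * 2 powr (q / p)"] conjI allI impI main) (use K in auto)
qed

section \<open>Passage to the Laplace transform on the weighted space\<close>

lemma laplace_eq_wave_transform:
  "laplace f z = (LBINT t. (indicator {0<..} t *\<^sub>R f t) * wave t z)"
  unfolding laplace_def set_lebesgue_integral_def wave_def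
  by (intro Bochner_Integration.integral_cong refl) (auto simp: indicator_def)

lemma measurable_laplace:
  fixes \<mu> :: "complex measure"
  assumes sets: "sets \<mu> = sets (restrict_space borel upper_half_plane)"
    and [measurable]: "(\<lambda>t. indicator {0<..} t *\<^sub>R f t) \<in> borel_measurable borel"
  shows "laplace f \<in> borel_measurable \<mu>"
proof -
  note [measurable] = measurable_wave[OF sets_upper_half_plane_eq(2)[OF sets]]
  have "laplace f = (\<lambda>z. LBINT t. (indicator {0<..} t *\<^sub>R f t) * wave t z)"
    by (intro ext laplace_eq_wave_transform)
  moreover have "\<dots> \<in> borel_measurable \<mu>" by measurable
  ultimately show ?thesis by (simp only:)
qed

lemma measurable_power_weight_iff:
  fixes f :: "real \<Rightarrow> 'a::real_normed_vector"
  shows "f \<in> borel_measurable (power_weight \<alpha>) \<longleftrightarrow> (\<lambda>t. indicator {0<..} t *\<^sub>R f t) \<in> borel_measurable borel"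
proof -
  have "f \<in> borel_measurable (power_weight \<alpha>) \<longleftrightarrow> f \<in> borel_measurable (restrict_space lborel {0<..})"
    unfolding power_weight_def by (simp cong: measurable_cong_sets)
  also have "\<dots> \<longleftrightarrow> (\<lambda>t. indicator {0<..} t *\<^sub>R f t) \<in> borel_measurable lborel"
    by (rule borel_measurable_restrict_space_iff) simp
  finally show ?thesis by simp
qed

lemma nn_integral_power_weight:
  fixes f :: "real \<Rightarrow> complex"
  assumes "f \<in> borel_measurable (power_weight \<alpha>)" "0 < p"
  shows "(\<integral>\<^sup>+t. ennreal (norm (f t) powr p) \<partial>power_weight \<alpha>)
    = (\<integral>\<^sup>+t. ennreal (t powr \<alpha> * norm (indicator {0<..} t *\<^sub>R f t) powr p) \<partial>lborel)"
proof -
  have [measurable]: "f \<in> borel_measurable (restrict_space lborel {0<..})"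
    using assms(1) unfolding power_weight_def by (simp cong: measurable_cong_sets)
  have "(\<lambda>t. t powr \<alpha>) \<in> borel_measurable lborel" by measurable
  then have [measurable]: "(\<lambda>t. t powr \<alpha>) \<in> borel_measurable (restrict_space lborel {0<..})"
    by (rule measurable_restrict_space1)
  have "(\<integral>\<^sup>+t. ennreal (norm (f t) powr p) \<partial>power_weight \<alpha>)
    = (\<integral>\<^sup>+t. ennreal (t powr \<alpha>) * ennreal (norm (f t) powr p) \<partial>restrict_space lborel {0<..})"
    unfolding power_weight_def by (subst nn_integral_density) auto
  also have "\<dots> = (\<integral>\<^sup>+t. ennreal (t powr \<alpha>) * ennreal (norm (f t) powr p) * indicator {0<..} t \<partial>lborel)"
    by (subst nn_integral_restrict_space) auto
  also have "\<dots> = (\<integral>\<^sup>+t. ennreal (t powr \<alpha> * norm (indicator {0<..} t *\<^sub>R f t) powr p) \<partial>lborel)"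
    by (intro nn_integral_cong) (auto simp: indicator_def ennreal_mult')
  finally show ?thesis .
qed

text \<open>The intervals [2^(-k), 2^k) exhaust the half-line. Dominated convergence in t gives
  pointwise convergence of the truncated transforms, and Fatou's lemma carries the uniform bound to
  the limit.\<close>

lemma nn_integral_wave_transform_le:
  fixes p q \<alpha> s C\<^sub>0 :: real and \<mu> :: "complex measure"
  assumes p: "2 < p" and pq: "p \<le> q"
    and s_def: "s = q * (1 - (1 + \<alpha>) / p)" and s: "0 < s"
    and sets: "sets \<mu> = sets (restrict_space borel upper_half_plane)"
    and C0: "0 < C\<^sub>0"
    and box: "\<And>a b. a < b \<Longrightarrow> emeasure \<mu> (carleson_box {a..b}) \<le> ennreal (C\<^sub>0 * (b - a) powr s)"
  shows "\<exists>K. 0 \<le> K \<and> (\<forall>F j. F \<in> borel_measurable borel \<longrightarrow> 0 < j \<longrightarrow>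
     (\<integral>\<^sup>+t. ennreal (t powr \<alpha> * norm (F t :: complex) powr p) \<partial>lborel) \<le> ennreal j \<longrightarrow>
     (\<integral>\<^sup>+z. ennreal (norm (LBINT t. F t * wave t z) powr q) \<partial>\<mu>) \<le> ennreal (K * j powr (q / p)))"
proof -
  obtain K where K: "0 \<le> K" and dyadic: "\<And>F j T0 n. F \<in> borel_measurable borel \<Longrightarrow> 0 < j \<Longrightarrow> 0 < T0 \<Longrightarrow>
     (\<integral>\<^sup>+t. ennreal (t powr \<alpha> * norm (F t :: complex) powr p) \<partial>lborel) \<le> ennreal j \<Longrightarrow>
     (\<integral>\<^sup>+z. ennreal (norm (LBINT t. (indicator {T0..<T0 * 2 ^ n} t *\<^sub>R F t) * wave t z) powr q) \<partial>\<mu>)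
       \<le> ennreal (K * j powr (q / p))"
    using nn_integral_wave_transform_dyadic_le[OF assms] by blast
  note id = sets_upper_half_plane_eq(2)[OF sets] and space = sets_upper_half_plane_eq(1)[OF sets]
  note [measurable] = measurable_wave[OF id]
  show ?thesis
  proof (intro exI[of _ K] conjI allI impI K)
    fix F :: "real \<Rightarrow> complex" and j :: real
    assume F[measurable]: "F \<in> borel_measurable borel" and j: "0 < j"
      and J: "(\<integral>\<^sup>+t. ennreal (t powr \<alpha> * norm (F t) powr p) \<partial>lborel) \<le> ennreal j"
    define I where "I k = {1 / 2 ^ k..<(2::real) ^ k}" for k :: nat
    have [measurable]: "I k \<in> sets borel" for k by (simp add: I_def)
    define h where "h k z = (LBINT t. (indicator (I k) t *\<^sub>R F t) * wave t z)" for k z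
    have h_le: "(\<integral>\<^sup>+z. ennreal (norm (h k z) powr q) \<partial>\<mu>) \<le> ennreal (K * j powr (q / p))" for k
    proof -
      \<comment> \<open>2k doublings lead from 2^(-k) to 2^k.\<close>
      have "(1 / 2 ^ k) * 2 ^ (2 * k) = (2::real) ^ k" by (simp add: mult_2 power_add)
      then show ?thesis using dyadic[OF F j _ J, of "1 / 2 ^ k" "2 * k"] unfolding h_def I_def by simp
    qed
    have h_meas[measurable]: "h k \<in> borel_measurable \<mu>" for k
      unfolding h_def[abs_def] by measurable
    have "(\<integral>\<^sup>+z. ennreal (norm (LBINT t. F t * wave t z) powr q) \<partial>\<mu>)
      \<le> (\<integral>\<^sup>+z. liminf (\<lambda>k. ennreal (norm (h k z) powr q)) \<partial>\<mu>)"
    proof (intro nn_integral_mono)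
      fix z assume z: "z \<in> space \<mu>"
      show "ennreal (norm (LBINT t. F t * wave t z) powr q) \<le> liminf (\<lambda>k. ennreal (norm (h k z) powr q))"
      proof (cases "integrable lborel (\<lambda>t. F t * wave t z)")
        \<comment> \<open>The integral takes the default value 0 here, so the left side
          vanishes.\<close>
        case False
        then show ?thesis by (simp add: not_integrable_integral_eq)
      next
        case True
        have "(\<lambda>k. h k z) \<longlonglongrightarrow> (LBINT t. F t * wave t z)"
          unfolding h_def
        proof (rule integral_dominated_convergence[where w = "\<lambda>t. norm (F t * wave t z)"])
          show "AE t in lborel. (\<lambda>k. (indicator (I k) t *\<^sub>R F t) * wave t z) \<longlonglongrightarrow> F t * wave t z"
          proof (intro AE_I2)
            fix t :: real
            show "(\<lambda>k. (indicator (I k) t *\<^sub>R F t) * wave t z) \<longlonglongrightarrow> F t * wave t z"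
            proof (cases "0 < t")
              case False
              then show ?thesis by (simp add: wave_def)
            next
              case t: True
              obtain n where n: "max t (1 / t) < 2 ^ n" using real_arch_pow[of 2 "max t (1 / t)"] by (auto simp del: max_less_iff_conj)
              have "t \<in> I k" if "n \<le> k" for k
              proof -
                have "(2::real) ^ n \<le> 2 ^ k" using that by simp
                then have "max t (1 / t) < 2 ^ k" using n by linarith
                then show ?thesis using t by (auto simp: I_def field_simps)
              qed
              then have "\<forall>\<^sub>F k in sequentially. (indicator (I k) t *\<^sub>R F t) * wave t z = F t * wave t z"
                by (auto simp: eventually_sequentially intro!: exI[of _ n])
              then show ?thesis by (rule tendsto_eventually)
            qed
          qed
          show "integrable lborel (\<lambda>t. norm (F t * wave t z))" using True by (rule integrable_norm)
          show "AE t in lborel. norm ((indicator (I k) t *\<^sub>R F t) * wave t z) \<le> norm (F t * wave t z)" for k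
            by (intro AE_I2) (auto simp: indicator_def)
        qed (use True z in measurable)
        then have "(\<lambda>k. ennreal (norm (h k z) powr q)) \<longlonglongrightarrow> ennreal (norm (LBINT t. F t * wave t z) powr q)"
          using p pq by (intro tendsto_ennrealI tendsto_powr' tendsto_norm tendsto_const) auto
        then have "liminf (\<lambda>k. ennreal (norm (h k z) powr q)) = ennreal (norm (LBINT t. F t * wave t z) powr q)"
          by (intro lim_imp_Liminf) auto
        then show ?thesis by simp
      qed
    qed
    also have "\<dots> \<le> liminf (\<lambda>k. \<integral>\<^sup>+z. ennreal (norm (h k z) powr q) \<partial>\<mu>)"
      by (intro nn_integral_liminf) measurable
    also have "\<dots> \<le> liminf (\<lambda>k::nat. ennreal (K * j powr (q / p)))"
      by (intro Liminf_mono always_eventually allI h_le)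
    also have "\<dots> = ennreal (K * j powr (q / p))"
      by (intro Liminf_const) simp
    finally show "(\<integral>\<^sup>+z. ennreal (norm (LBINT t. F t * wave t z) powr q) \<partial>\<mu>) \<le> ennreal (K * j powr (q / p))" .
  qed
qed

lemma bounded_laplace_if_carleson:
  fixes p q \<alpha> s C\<^sub>0 :: real and \<mu> :: "complex measure"
  assumes p: "2 < p" and pq: "p \<le> q"
    and s_def: "s = q * (1 - (1 + \<alpha>) / p)" and s: "0 < s"
    and sets: "sets \<mu> = sets (restrict_space borel upper_half_plane)"
    and C0: "0 < C\<^sub>0"
    and box: "\<And>a b. a < b \<Longrightarrow> emeasure \<mu> (carleson_box {a..b}) \<le> ennreal (C\<^sub>0 * (b - a) powr s)"
  shows "bounded_Lp_Lq (power_weight \<alpha>) p \<mu> q laplace"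
proof -
  obtain K where K: "0 \<le> K" and K_le: "\<And>F j. F \<in> borel_measurable borel \<Longrightarrow> 0 < j \<Longrightarrow>
     (\<integral>\<^sup>+t. ennreal (t powr \<alpha> * norm (F t :: complex) powr p) \<partial>lborel) \<le> ennreal j \<Longrightarrow>
     (\<integral>\<^sup>+z. ennreal (norm (LBINT t. F t * wave t z) powr q) \<partial>\<mu>) \<le> ennreal (K * j powr (q / p))"
    using nn_integral_wave_transform_le[OF assms] by blast
  have q: "0 < q" using p pq by simp
  show ?thesis
    unfolding bounded_Lp_Lq_def
  proof (intro exI[of _ "K powr (1 / q) + 1"] conjI ballI)
    \<comment> \<open>The summand 1 is there because K may be 0, while a bound C > 0 is
      required.\<close>
    show "0 < K powr (1 / q) + 1" by (simp add: add_nonneg_pos)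
    fix f assume "f \<in> Lp_space (power_weight \<alpha>) p"
    then have f: "f \<in> borel_measurable (power_weight \<alpha>)"
      and f_int: "integrable (power_weight \<alpha>) (\<lambda>t. norm (f t) powr p)" by (auto simp: Lp_space_def)
    have F[measurable]: "(\<lambda>t. indicator {0<..} t *\<^sub>R f t) \<in> borel_measurable borel"
      using f by (simp add: measurable_power_weight_iff)
    define J where "J = (LINT t|power_weight \<alpha>. norm (f t) powr p)"
    have J0: "0 \<le> J" by (simp add: J_def)
    have J: "(\<integral>\<^sup>+t. ennreal (t powr \<alpha> * norm (indicator {0<..} t *\<^sub>R f t) powr p) \<partial>lborel) = ennreal J"
    proof -
      have "(\<integral>\<^sup>+t. ennreal (norm (f t) powr p) \<partial>power_weight \<alpha>) = ennreal J"
        unfolding J_def by (rule nn_integral_eq_integral[OF f_int]) simp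
      then show ?thesis using nn_integral_power_weight[OF f, of p] p by simp
    qed
    \<comment> \<open>Any j strictly above J is positive, even when f vanishes almost everywhere.
      The value J + 1 gives membership in the target space, and j = J + 1/(n+1) tending to J gives
      the norm bound.\<close>
    have L_le: "(\<integral>\<^sup>+z. ennreal (norm (laplace f z) powr q) \<partial>\<mu>) \<le> ennreal (K * j powr (q / p))" if "J < j" for j
      unfolding laplace_eq_wave_transform
    proof (rule K_le[OF F])
      show "0 < j" using that J0 by simp
      show "(\<integral>\<^sup>+t. ennreal (t powr \<alpha> * norm (indicator {0<..} t *\<^sub>R f t) powr p) \<partial>lborel) \<le> ennreal j"
        unfolding J using that by (intro ennreal_leI) simp
    qed
    have L_meas[measurable]: "laplace f \<in> borel_measurable \<mu>" by (intro measurable_laplace sets F)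
    have L_int: "integrable \<mu> (\<lambda>z. norm (laplace f z) powr q)"
    proof (rule integrableI_bounded)
      show "(\<integral>\<^sup>+z. ennreal (norm (norm (laplace f z) powr q)) \<partial>\<mu>) < \<infinity>"
      proof (rule le_less_trans)
        show "(\<integral>\<^sup>+z. ennreal (norm (norm (laplace f z) powr q)) \<partial>\<mu>) \<le> ennreal (K * (J + 1) powr (q / p))"
          using L_le[of "J + 1"] by simp
      qed simp
    qed measurable
    then show "laplace f \<in> Lp_space \<mu> q" by (simp add: Lp_space_def)
    define X where "X = (LINT z|\<mu>. norm (laplace f z) powr q)"
    have X_le: "X \<le> K * (J + 1 / Suc n) powr (q / p)" for n
    proof -
      have "ennreal X \<le> ennreal (K * (J + 1 / Suc n) powr (q / p))"
        unfolding X_def using L_le[of "J + 1 / Suc n"] nn_integral_eq_integral[OF L_int] by simp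
      then show ?thesis using K by (subst (asm) ennreal_le_iff) auto
    qed
    have "(\<lambda>n. J + 1 / real (Suc n)) \<longlonglongrightarrow> J + 0"
      by (intro tendsto_add tendsto_const LIMSEQ_Suc[OF lim_inverse_n'])
    then have "(\<lambda>n. (J + 1 / real (Suc n)) powr (q / p)) \<longlonglongrightarrow> (J + 0) powr (q / p)"
      using p q J0 by (intro tendsto_powr' tendsto_const) (auto intro!: always_eventually)
    then have "(\<lambda>n. K * (J + 1 / Suc n) powr (q / p)) \<longlonglongrightarrow> K * (J + 0) powr (q / p)"
      by (intro tendsto_mult tendsto_const)
    then have "X \<le> K * J powr (q / p)"
      using LIMSEQ_le_const[of "\<lambda>n. K * (J + 1 / Suc n) powr (q / p)" "K * (J + 0) powr (q / p)" X] X_le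
      by (simp only: add_0_right) blast
    moreover have "0 \<le> X" by (simp add: X_def)
    ultimately have "X powr (1 / q) \<le> (K * J powr (q / p)) powr (1 / q)"
      using q by (intro powr_mono2) auto
    also have "\<dots> = K powr (1 / q) * J powr (1 / p)"
      using q by (simp add: powr_mult powr_powr)
    also have "\<dots> \<le> (K powr (1 / q) + 1) * J powr (1 / p)" by (simp add: distrib_right)
    finally show "Lp_norm \<mu> q (laplace f) \<le> (K powr (1 / q) + 1) * Lp_norm (power_weight \<alpha>) p f"
      by (simp add: Lp_norm_def X_def J_def)
  qed
qed

section \<open>Necessity of the Carleson condition\<close>

text \<open>Boundedness is essential: \<open>measure\<close> is 0 on a set of infinite measure, so
  the bound fails on unbounded intervals.\<close>

lemma dist_le_measure_interval:
  fixes I :: "real set"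
  assumes "is_interval I" "bounded I" "x \<in> I" "y \<in> I"
  shows "\<bar>x - y\<bar> \<le> measure lborel I"
proof -
  have "{min x y..max x y} \<subseteq> I"
    using mem_is_interval_1_I[OF assms(1,3,4)] mem_is_interval_1_I[OF assms(1,4,3)]
    by (cases "x \<le> y") auto
  moreover have "I \<in> fmeasurable lborel"
    using emeasure_bounded_finite[OF assms(2)] real_interval_borel_measurable[OF assms(1)]
    by (intro fmeasurableI) simp_all
  ultimately have "measure lborel {min x y..max x y} \<le> measure lborel I"
    by (intro measure_mono_fmeasurable) auto
  then show ?thesis by (simp add: min_def max_def split: if_splits)
qed

text \<open>
  Tested on a character cut off to \<open>[a, 2 a]\<close> with \<open>a\<close> comparable to \<open>1/|I|\<close>: on the box over \<open>I\<close>
  the integrand of the transform then hardly oscillates.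
\<close>

lemma carleson_if_bounded_laplace:
  fixes p q \<alpha> s :: real and \<mu> :: "complex measure"
  assumes p: "0 < p" and q: "0 < q"
    and s_def: "s = q * (1 - (1 + \<alpha>) / p)"
    and sets: "sets \<mu> = sets (restrict_space borel upper_half_plane)"
    and bdd: "bounded_Lp_Lq (power_weight \<alpha>) p \<mu> q laplace"
  shows "\<exists>C\<^sub>0>0. \<forall>I :: real set. is_interval I \<and> bounded I \<longrightarrow>
    emeasure \<mu> (carleson_box I) \<le> ennreal (C\<^sub>0 * measure lborel I powr s)"
proof -
  obtain C where C: "0 < C" and C_le: "\<And>f. f \<in> Lp_space (power_weight \<alpha>) p \<Longrightarrow>
      laplace f \<in> Lp_space \<mu> q \<and> Lp_norm \<mu> q (laplace f) \<le> C * Lp_norm (power_weight \<alpha>) p f"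
    using bdd by (auto simp: bounded_Lp_Lq_def)
  \<comment> \<open>On the box both the damping 2 pi t Im z and the phase 2 pi t |Re z - x0| are at
    most 1; exp (-1) and cos 1 bound the two factors of the real part from below.\<close>
  define \<kappa> where "\<kappa> = exp (-1) * cos (1::real)"
  have "0 < cos (1::real)" using pi_gt3 by (intro cos_gt_zero) auto
  then have kappa: "0 < \<kappa>" by (simp add: \<kappa>_def)
  define C\<^sub>0 where "C\<^sub>0 = C powr q * (2 powr \<bar>\<alpha>\<bar>) powr (q / p) / \<kappa> powr q * (4 * pi) powr s"
  have C0: "0 < C\<^sub>0" using C kappa by (simp add: C\<^sub>0_def)
  have "emeasure \<mu> (carleson_box I) \<le> ennreal (C\<^sub>0 * measure lborel I powr s)"
    if I: "is_interval I" "bounded I" for I :: "real set"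
  proof (cases "I = {} \<or> measure lborel I = 0")
    case True
    \<comment> \<open>A null interval, such as a point, leaves no height: 0 < Im z \<le> 0 is
      impossible.\<close>
    then have "carleson_box I = {}" by (auto simp: carleson_box_def)
    then show ?thesis by simp
  next
    case False
    define l where "l = measure lborel I"
    have l: "0 < l" using False by (simp add: l_def zero_less_measure_iff)
    obtain x0 where x0: "x0 \<in> I" using False by auto
    \<comment> \<open>Chosen so that 2 pi t l \<le> 1 up to t = 2a, with equality there.\<close>
    define a where "a = 1 / (4 * pi * l)"
    have a: "0 < a" using l by (simp add: a_def)
    \<comment> \<open>The modulation moves the peak of the transform to x0: the exponent becomes a
      multiple of z - x0.\<close>
    define f where "f t = indicator {a..2 * a} t *\<^sub>R exp (- (2 * of_real pi * \<i> * of_real t * of_real x0))" for t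
    have f_meas[measurable]: "f \<in> borel_measurable borel" unfolding f_def[abs_def] by measurable
    have f_pos: "indicator {0<..} t *\<^sub>R f t = f t" for t using a by (auto simp: f_def indicator_def)
    have norm_f: "norm (f t) = indicator {a..2 * a} t" for t by (simp add: f_def)
    have f_meas': "f \<in> borel_measurable (power_weight \<alpha>)"
      using f_meas by (simp add: measurable_power_weight_iff f_pos)
    have "(\<integral>\<^sup>+t. ennreal (norm (f t) powr p) \<partial>power_weight \<alpha>)
        = (\<integral>\<^sup>+t. ennreal (t powr \<alpha> * norm (f t) powr p) \<partial>lborel)"
      using nn_integral_power_weight[OF f_meas' p] by (simp add: f_pos)
    also have "\<dots> \<le> (\<integral>\<^sup>+t. ennreal (2 powr \<bar>\<alpha>\<bar> * a powr \<alpha>) * indicator {a..2 * a} t \<partial>lborel)"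
    proof (intro nn_integral_mono)
      fix t
      have "t powr \<alpha> \<le> 2 powr \<bar>\<alpha>\<bar> * a powr \<alpha>" if t: "a \<le> t" "t \<le> 2 * a"
      proof -
        have "(t / a) powr \<alpha> \<le> (t / a) powr \<bar>\<alpha>\<bar>" using t a by (intro powr_mono) auto
        also have "\<dots> \<le> 2 powr \<bar>\<alpha>\<bar>" using t a by (intro powr_mono2) (auto simp: field_simps)
        finally show ?thesis using a t by (simp add: powr_divide field_simps)
      qed
      then show "ennreal (t powr \<alpha> * norm (f t) powr p) \<le> ennreal (2 powr \<bar>\<alpha>\<bar> * a powr \<alpha>) * indicator {a..2 * a} t"
        by (auto simp: norm_f indicator_def intro: ennreal_leI)
    qed
    also have "\<dots> = ennreal (2 powr \<bar>\<alpha>\<bar> * a powr \<alpha>) * ennreal a"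
      using a by (simp add: nn_integral_cmult_indicator)
    also have "\<dots> = ennreal (2 powr \<bar>\<alpha>\<bar> * a powr (\<alpha> + 1))"
      using a by (simp add: powr_add mult.assoc flip: ennreal_mult')
    finally have J_le: "(\<integral>\<^sup>+t. ennreal (norm (f t) powr p) \<partial>power_weight \<alpha>) \<le> ennreal (2 powr \<bar>\<alpha>\<bar> * a powr (\<alpha> + 1))" .
    have f_int: "integrable (power_weight \<alpha>) (\<lambda>t. norm (f t) powr p)"
      using J_le f_meas' by (intro integrableI_bounded) (auto intro: le_less_trans)
    define J where "J = (LINT t|power_weight \<alpha>. norm (f t) powr p)"
    have "ennreal J \<le> ennreal (2 powr \<bar>\<alpha>\<bar> * a powr (\<alpha> + 1))"
      using J_le f_int unfolding J_def by (subst (asm) nn_integral_eq_integral) auto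
    then have J: "J \<le> 2 powr \<bar>\<alpha>\<bar> * a powr (\<alpha> + 1)"
      by (subst (asm) ennreal_le_iff) auto
    have J0: "0 \<le> J" by (simp add: J_def)
    have "f \<in> Lp_space (power_weight \<alpha>) p" using f_int f_meas' by (simp add: Lp_space_def)
    note Lf = C_le[OF this]
    define X where "X = (LINT z|\<mu>. norm (laplace f z) powr q)"
    have X0: "0 \<le> X" by (simp add: X_def)
    have L_int: "integrable \<mu> (\<lambda>z. norm (laplace f z) powr q)" using Lf by (simp add: Lp_space_def)
    have "X = (X powr (1 / q)) powr q" using q X0 by (simp add: powr_powr)
    also have "\<dots> \<le> (C * J powr (1 / p)) powr q"
      using Lf q by (intro powr_mono2) (auto simp: Lp_norm_def X_def J_def)
    also have "\<dots> = C powr q * J powr (q / p)" by (simp add: powr_mult powr_powr)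
    also have "\<dots> \<le> C powr q * (2 powr \<bar>\<alpha>\<bar> * a powr (\<alpha> + 1)) powr (q / p)"
      using J J0 p q by (intro mult_left_mono powr_mono2) auto
    finally have X_le: "X \<le> C powr q * (2 powr \<bar>\<alpha>\<bar> * a powr (\<alpha> + 1)) powr (q / p)" .
    have lower: "\<kappa> * a \<le> norm (laplace f z)" if z: "z \<in> carleson_box I" for z
    proof -
      have Rez: "Re z \<in> I" and Imz: "0 < Im z" "Im z \<le> l" using z by (auto simp: carleson_box_def l_def)
      have dx: "\<bar>Re z - x0\<bar> \<le> l" unfolding l_def by (rule dist_le_measure_interval[OF I Rez x0])
      define E where "E t = indicator {a..2 * a} t *\<^sub>R exp (2 * of_real pi * \<i> * of_real t * (z - of_real x0))" for t
      have L_eq: "laplace f z = (LBINT t. E t)"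
        unfolding laplace_def set_lebesgue_integral_def
      proof (intro Bochner_Integration.integral_cong refl)
        fix t :: real
        show "indicator {0<..} t *\<^sub>R (f t * exp (2 * of_real pi * \<i> * of_real t * z)) = E t"
          using a by (auto simp: f_def E_def indicator_def right_diff_distrib simp flip: exp_add)
      qed
      have ReE: "\<kappa> \<le> Re (exp (2 * of_real pi * \<i> * of_real t * (z - of_real x0)))" if t: "t \<in> {a..2 * a}" for t
      proof -
        have "2 * pi * t * l \<le> 2 * pi * (2 * a) * l" using t l by (intro mult_right_mono mult_left_mono) auto
        also have "\<dots> = 1" using l by (simp add: a_def)
        finally have tl: "2 * pi * t * l \<le> 1" .
        have t0: "0 \<le> 2 * pi * t" using t a by auto
        have "2 * pi * t * Im z \<le> 2 * pi * t * l" using t0 Imz by (intro mult_left_mono) auto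
        then have "2 * pi * t * Im z \<le> 1" using tl by (rule order_trans)
        then have e: "exp (-1) \<le> exp (- (2 * pi * t * Im z))" by simp
        have "\<bar>2 * pi * t * (Re z - x0)\<bar> = 2 * pi * t * \<bar>Re z - x0\<bar>"
          by (subst abs_mult) (use t0 in simp)
        also have "\<dots> \<le> 2 * pi * t * l" using t0 dx by (intro mult_left_mono) auto
        finally have arg: "\<bar>2 * pi * t * (Re z - x0)\<bar> \<le> 1" using tl by linarith
        have "cos 1 \<le> cos \<bar>2 * pi * t * (Re z - x0)\<bar>"
          using arg pi_gt3 by (intro cos_monotone_0_pi_le) auto
        then have "cos 1 \<le> cos (2 * pi * t * (Re z - x0))" by simp
        then have "\<kappa> \<le> exp (- (2 * pi * t * Im z)) * cos (2 * pi * t * (Re z - x0))"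
          unfolding \<kappa>_def using e \<open>0 < cos 1\<close> by (intro mult_mono) auto
        then show ?thesis by (simp add: Re_exp)
      qed
      have "continuous_on {a..2 * a} (\<lambda>t. exp (2 * of_real pi * \<i> * of_real t * (z - of_real x0)))"
        by (intro continuous_intros)
      then have E_int: "integrable lborel E"
        unfolding E_def[abs_def] by (intro borel_integrable_compact compact_Icc)
      have ind: "integrable lborel (indicat_real {a..2 * a})"
        using a by (intro integrable_real_indicator) auto
      have "\<kappa> * a = measure lborel {a..2 * a} *\<^sub>R \<kappa>"
        using a by simp
      also have "\<dots> = (LBINT t. indicator {a..2 * a} t *\<^sub>R \<kappa>)"
        unfolding integral_scaleR_left[OF ind] by (subst Bochner_Integration.integral_indicator) simp
      also have "\<dots> \<le> (LBINT t. Re (E t))"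
        using ReE by (intro integral_mono[OF integrable_scaleR_left[OF ind] integrable_Re[OF E_int]]) (auto simp: E_def indicator_def)
      also have "\<dots> = Re (laplace f z)" unfolding L_eq using E_int by simp
      also have "\<dots> \<le> norm (laplace f z)" by (rule complex_Re_le_cmod)
      finally show ?thesis .
    qed
    have box_sets[measurable]: "carleson_box I \<in> sets \<mu>" by (rule carleson_box_sets[OF sets I(1)])
    have "ennreal ((\<kappa> * a) powr q) * emeasure \<mu> (carleson_box I)
        = (\<integral>\<^sup>+z. ennreal ((\<kappa> * a) powr q) * indicator (carleson_box I) z \<partial>\<mu>)"
      by (simp add: nn_integral_cmult_indicator)
    also have "\<dots> \<le> (\<integral>\<^sup>+z. ennreal (norm (laplace f z) powr q) \<partial>\<mu>)"
      using lower kappa a q by (intro nn_integral_mono) (auto simp: indicator_def intro!: ennreal_leI powr_mono2)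
    also have "\<dots> = ennreal X" unfolding X_def using L_int by (intro nn_integral_eq_integral) auto
    also have "\<dots> \<le> ennreal (C powr q * (2 powr \<bar>\<alpha>\<bar> * a powr (\<alpha> + 1)) powr (q / p))"
      using X_le by (rule ennreal_leI)
    finally have "ennreal (1 / (\<kappa> * a) powr q) * (ennreal ((\<kappa> * a) powr q) * emeasure \<mu> (carleson_box I))
      \<le> ennreal (1 / (\<kappa> * a) powr q) * ennreal (C powr q * (2 powr \<bar>\<alpha>\<bar> * a powr (\<alpha> + 1)) powr (q / p))"
      by (intro mult_left_mono) auto
    also have "ennreal (1 / (\<kappa> * a) powr q) * (ennreal ((\<kappa> * a) powr q) * emeasure \<mu> (carleson_box I))
      = emeasure \<mu> (carleson_box I)"
      using kappa a by (simp flip: mult.assoc ennreal_mult')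
    also have "ennreal (1 / (\<kappa> * a) powr q) * ennreal (C powr q * (2 powr \<bar>\<alpha>\<bar> * a powr (\<alpha> + 1)) powr (q / p))
      = ennreal (1 / (\<kappa> * a) powr q * (C powr q * (2 powr \<bar>\<alpha>\<bar> * a powr (\<alpha> + 1)) powr (q / p)))"
      by (simp flip: ennreal_mult')
    also have "1 / (\<kappa> * a) powr q * (C powr q * (2 powr \<bar>\<alpha>\<bar> * a powr (\<alpha> + 1)) powr (q / p))
      = C powr q * (2 powr \<bar>\<alpha>\<bar>) powr (q / p) / \<kappa> powr q * (a powr ((\<alpha> + 1) * (q / p)) / a powr q)"
      by (simp add: powr_mult powr_powr)
    \<comment> \<open>Test norm to the power q over the lower bound a^q: the exponent (\<alpha> + 1)
      q/p - q is -s, and a is comparable to 1/l, which yields l^s.\<close>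
    also have "a powr ((\<alpha> + 1) * (q / p)) / a powr q = a powr (- s)"
    proof -
      have "(\<alpha> + 1) * (q / p) - q = - s" using p by (simp add: s_def field_simps)
      then show ?thesis by (simp only: powr_diff[symmetric])
    qed
    also have "a powr (- s) = (4 * pi) powr s * l powr s"
    proof -
      have "a powr (- s) = (4 * pi * l) powr s"
        unfolding a_def using l by (simp only: powr_minus powr_one_eq_one powr_divide) simp
      then show ?thesis by (simp only: powr_mult)
    qed
    finally show ?thesis by (simp add: C\<^sub>0_def l_def mult.assoc)
  qed
  then show ?thesis using C0 by blast
qed

theorem theorem1p7:
  fixes p q \<alpha> :: real and \<mu> :: "complex measure"
  assumes "2 < p" and "p \<le> q"
    and "\<alpha> \<le> p / conj_exponent q - 1"
    and "sets \<mu> = sets (restrict_space borel upper_half_plane)"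
  shows "bounded_Lp_Lq (power_weight \<alpha>) p \<mu> q laplace \<longleftrightarrow>
    (\<exists>C\<^sub>0>0. \<forall>I :: real set. is_interval I \<and> bounded I \<longrightarrow>
       emeasure \<mu> (carleson_box I)
         \<le> ennreal (C\<^sub>0 * measure lborel I powr (q / conj_exponent p - \<alpha> * q / p)))"
proof -
  define s where "s = q * (1 - (1 + \<alpha>) / p)"
  have pq: "0 < p" "0 < q" using assms by auto
  have s_eq: "q / conj_exponent p - \<alpha> * q / p = s"
  proof -
    have "s = (q * p - q * (1 + \<alpha>)) / p"
      using pq by (simp add: s_def diff_divide_distrib right_diff_distrib)
    also have "q * p - q * (1 + \<alpha>) = q * (p - 1) - \<alpha> * q" by (simp add: algebra_simps)
    also have "\<dots> / p = q / conj_exponent p - \<alpha> * q / p"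
      by (simp add: conj_exponent_def diff_divide_distrib)
    finally show ?thesis by (rule sym)
  qed
  have "p / conj_exponent q = p * (1 - 1 / q)"
    using pq by (simp add: conj_exponent_def diff_divide_distrib right_diff_distrib)
  \<comment> \<open>Since 1/q' = 1 - 1/q, the hypothesis on \<alpha> says s \<ge> 1, and in
    particular s is positive.\<close>
  then have "1 + \<alpha> \<le> p * (1 - 1 / q)" using assms(3) by linarith
  then have "(1 + \<alpha>) / p \<le> 1 - 1 / q" using pq by (simp only: pos_divide_le_eq mult.commute)
  also have "\<dots> < 1" using pq by simp
  finally have s: "0 < s" using pq by (simp add: s_def)
  show ?thesis
    unfolding s_eq
  proof
    assume "bounded_Lp_Lq (power_weight \<alpha>) p \<mu> q laplace"
    then show "\<exists>C\<^sub>0>0. \<forall>I :: real set. is_interval I \<and> bounded I \<longrightarrow>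
        emeasure \<mu> (carleson_box I) \<le> ennreal (C\<^sub>0 * measure lborel I powr s)"
      by (rule carleson_if_bounded_laplace[OF pq s_def assms(4)])
  next
    assume "\<exists>C\<^sub>0>0. \<forall>I :: real set. is_interval I \<and> bounded I \<longrightarrow>
        emeasure \<mu> (carleson_box I) \<le> ennreal (C\<^sub>0 * measure lborel I powr s)"
    then obtain C\<^sub>0 where C0: "0 < C\<^sub>0" and box: "\<And>I :: real set. is_interval I \<Longrightarrow> bounded I \<Longrightarrow>
        emeasure \<mu> (carleson_box I) \<le> ennreal (C\<^sub>0 * measure lborel I powr s)" by blast
    have "emeasure \<mu> (carleson_box {a..b}) \<le> ennreal (C\<^sub>0 * (b - a) powr s)" if "a < b" for a b
      using box[of "{a..b}"] that by simp
    then show "bounded_Lp_Lq (power_weight \<alpha>) p \<mu> q laplace"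
      by (rule bounded_laplace_if_carleson[OF assms(1,2) s_def s assms(4) C0])
  qed
qed

end
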